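(* Let $q$ be a prime power, and let $n,r$ be integers with $n \geq 4$ and $2 \leq r \leq \left\lfloor \frac{n}{2} \right\rfloor$. Then $$q^{3(n-r)}\,2^{q^{(n-r)(r-1)}} \leq s_q(r,n).$$
   Context: For a finite-dimensional vector space $E$ over $\mathbb F_q$, let $\mathcal L(E)$ denote the set of all linear subspaces of $E$. A $q$-matroid is a pair $M=(E,\rho)$ with $\rho:\mathcal L(E)\to\mathbb Z_{\ge 0}$ such that for all $V,W\in\mathcal L(E)$: (R1) $0\le\rho(V)\le\dim V$; (R2) $V\le W$ implies $\rho(V)\le\rho(W)$; (R3) $\rho(V+W)+\rho(V\cap W)\le\rho(V)+\rho(W)$. $E$ is the ground space and $\rho(E)$ the rank of $M$. A subspace $V\le E$ is independent if $\rho(V)=\dim V$, otherwise dependent; a circuit is a dependent subspace all of whose proper subspaces are independent. A $q$-matroid of rank $r$ is paving if every circuit has dimension at least $r$; it is sparse-paving if it is paving and any two distinct circuits of dimension $r$ intersect in a subspace of dimension at most $r-2$. $s_q(r,n)$ denotes the number of sparse-paving $q$-matroids with ground space $\mathbb F_q^n$ and rank $r$ (counted as distinct whenever they are not equal, i.e. not up to isomorphism). *)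

theory Defs
  imports "HOL-Analysis.Analysis"
begin

(* Subspaces, spans and dimensions are those of the library interpretation vec, i.e. of
   'a ^ 'n as a vector space over the field 'a itself (and not over the reals). *)

definition subspaces_of :: "('a::field ^ 'n) set \<Rightarrow> ('a ^ 'n) set set" where
  "subspaces_of E = {V. vec.subspace V \<and> V \<subseteq> E}"

definition subspace_sum :: "('a::field ^ 'n) set \<Rightarrow> ('a ^ 'n) set \<Rightarrow> ('a ^ 'n) set" where
  "subspace_sum V W = {v + w | v w. v \<in> V \<and> w \<in> W}"

(* The ground space E is any subspace of 'a ^ 'n. Extensionality fixes the values of rho outside
   the lattice of subspaces of E, so that equality of q-matroids on E is equality of the
   functions rho. Nonnegativity of rho is built into the type nat. *)
definition q_matroid :: "('a::field ^ 'n) set \<Rightarrow> (('a ^ 'n) set \<Rightarrow> nat) \<Rightarrow> bool" where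
  "q_matroid E \<rho> \<longleftrightarrow>
     vec.subspace E \<and> \<rho> \<in> extensional (subspaces_of E) \<and>
     (\<forall>V\<in>subspaces_of E. \<rho> V \<le> vec.dim V) \<and>
     (\<forall>V\<in>subspaces_of E. \<forall>W\<in>subspaces_of E. V \<subseteq> W \<longrightarrow> \<rho> V \<le> \<rho> W) \<and>
     (\<forall>V\<in>subspaces_of E. \<forall>W\<in>subspaces_of E.
        \<rho> (subspace_sum V W) + \<rho> (V \<inter> W) \<le> \<rho> V + \<rho> W)"

definition independent_space ::
  "('a::field ^ 'n) set \<Rightarrow> (('a ^ 'n) set \<Rightarrow> nat) \<Rightarrow> ('a ^ 'n) set \<Rightarrow> bool" where
  "independent_space E \<rho> V \<longleftrightarrow> V \<in> subspaces_of E \<and> \<rho> V = vec.dim V"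

definition dependent_space ::
  "('a::field ^ 'n) set \<Rightarrow> (('a ^ 'n) set \<Rightarrow> nat) \<Rightarrow> ('a ^ 'n) set \<Rightarrow> bool" where
  "dependent_space E \<rho> V \<longleftrightarrow> V \<in> subspaces_of E \<and> \<rho> V \<noteq> vec.dim V"

definition circuit ::
  "('a::field ^ 'n) set \<Rightarrow> (('a ^ 'n) set \<Rightarrow> nat) \<Rightarrow> ('a ^ 'n) set \<Rightarrow> bool" where
  "circuit E \<rho> C \<longleftrightarrow>
     dependent_space E \<rho> C \<and>
     (\<forall>V. vec.subspace V \<and> V \<subset> C \<longrightarrow> independent_space E \<rho> V)"

definition paving :: "('a::field ^ 'n) set \<Rightarrow> (('a ^ 'n) set \<Rightarrow> nat) \<Rightarrow> bool" where
  "paving E \<rho> \<longleftrightarrow> (\<forall>C. circuit E \<rho> C \<longrightarrow> \<rho> E \<le> vec.dim C)"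

(* The bound dim (C \<inter> D) \<le> r - 2 is written additively because subtraction on nat truncates. *)
definition sparse_paving :: "('a::field ^ 'n) set \<Rightarrow> (('a ^ 'n) set \<Rightarrow> nat) \<Rightarrow> bool" where
  "sparse_paving E \<rho> \<longleftrightarrow>
     paving E \<rho> \<and>
     (\<forall>C D. circuit E \<rho> C \<and> circuit E \<rho> D \<and> C \<noteq> D \<and>
            vec.dim C = \<rho> E \<and> vec.dim D = \<rho> E \<longrightarrow>
            vec.dim (C \<inter> D) + 2 \<le> \<rho> E)"

(* The number s_q(r,n), where the field F_q is the type 'a with q = CARD('a), and n = CARD('n). *)
definition num_sparse_paving :: "('a::{field,finite} ^ 'n) itself \<Rightarrow> nat \<Rightarrow> nat" where
  "num_sparse_paving _ r =
     card {\<rho> :: ('a ^ 'n) set \<Rightarrow> nat. q_matroid UNIV \<rho> \<and> \<rho> UNIV = r \<and> sparse_paving UNIV \<rho>}"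

end

theory Submission
  imports Defs "HOL-Algebra.Algebraic_Closure_Type"
begin

text \<open>A set of $r$-dimensional subspaces that pairwise meet in dimension at most $r - 2$ (a code)
  is the set of $r$-dimensional circuits of a sparse-paving $q$-matroid of rank $r$, so it suffices to
  count codes. Put $m = n - r$ and let $S$ be a subspace of dimension $m$. The complements of $S$ are
  the graphs of the $r$-tuples $v$ of vectors of $S$. The $N = q^{m(r-1)}$ tuples with
  $v_0 = w + \sum_{k \ge 1} B_k v_k$ form a code whenever the operators $1, B_1, \dots, B_{r-1}$ span an
  $r$-dimensional space of operators on $S$ whose nonzero elements are all injective; multiplication in the field with
  $q^m$ elements, transported to $S$ by many linear isomorphisms, yields many such systems. Two of these
  codes share at most $N/q$ elements, so all their subsets with more than $N/q$ elements are distinct,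
  and these are at least a quarter (for $q \ge 3$, a half) of the $2^N$ subsets. A final factor of
  about $q^m$ comes from letting $W$ run through the $r$-dimensional spaces that contain a fixed
  space of dimension $r - 1$, choosing $S \supseteq W$ and adding $W$ to each subset. This suffices for $m \ge 3$.
  For $m = 2$ (so $r = 2$ and $n = 4$) and $q \ge 3$ one needs operators with three different
  characteristic polynomials. For $q = 2$ and $n = 4$ the partial spreads with at most
  four elements are counted directly by extending them one line at a time.\<close>

subsection \<open>Sparse-paving q-matroids from codes\<close>

text \<open>Written as matrices with \<open>r\<close> rows, the tuples of one code have pairwise
  differences of rank at least 2, and N is the largest size possible (a maximum rank distance code).
  The case split comes from arithmetic. With k operator systems, q^m translations w and a share 1/c
  of large subsets, one space S yields k q^m 2^N / c codes. As k < q^(2m) for the systems used, this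
  stays below q^(3m) 2^N, and the missing factor (q^(m+1) - 1) / (q - 1) is the number of spaces W.
  For m >= 3, prescribing the images of 1, x, x^2 under an isomorphism gives k = (q^m - q)(q^m -
  q^2), which leaves room even for c = 4. For m = 2 only the images of 1 and x are free, so one
  characteristic polynomial gives k = q^2 - q. The product (q^2 - q) q^2 (q^3 - 1) / (q - 1) = q^3
  (q^3 - 1) is just below q^6, so two polynomials barely fail to compensate c = 2, and three
  suffice. Over two elements x^2 + x + 1 is the only monic quadratic without roots, so this way is
  closed.\<close>

lemma (in vector_space) card_span_independent:
  assumes "finite (UNIV :: 'a set)" "finite B" "independent B"
  shows "card (span B) = CARD('a) ^ card B"
  using assms(2,3)
proof (induction B rule: finite_induct)
  case empty
  then show ?case by simp
next
  case (insert x B)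
  have ind: "independent B" and x: "x \<notin> span B"
    using insert.prems insert.hyps by (auto simp: independent_insert)
  define f where "f = (\<lambda>(c, y). scale c x + y)"
  have inj: "inj_on f (UNIV \<times> span B)"
  proof (rule inj_onI, clarsimp simp: f_def)
    fix c y c' y'
    assume y: "y \<in> span B" "y' \<in> span B" and eq: "scale c x + y = scale c' x + y'"
    have "scale (c - c') x = y' - y"
      using eq by (simp add: scale_left_diff_distrib algebra_simps)
    then have "scale (c - c') x \<in> span B"
      using y by (simp add: span_diff)
    then have "scale (inverse (c - c')) (scale (c - c') x) \<in> span B"
      by (rule span_scale)
    then have "c = c'"
      using x by (cases "c - c' = 0") auto
    then show "c = c' \<and> y = y'"
      using eq by simp
  qed
  have img: "f ` (UNIV \<times> span B) = span (insert x B)"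
  proof (intro equalityI subsetI)
    fix z assume "z \<in> f ` (UNIV \<times> span B)"
    then obtain c y where "z = scale c x + y" "y \<in> span B"
      by (auto simp: f_def)
    then show "z \<in> span (insert x B)"
      by (auto intro!: span_add span_scale simp: span_base span_superset
          intro: set_mp[OF span_mono[of B "insert x B"]])
  next
    fix z assume "z \<in> span (insert x B)"
    then obtain k where k: "z - scale k x \<in> span B"
      by (metis span_breakdown_eq)
    have "z = f (k, z - scale k x)"
      by (simp add: f_def)
    then show "z \<in> f ` (UNIV \<times> span B)"
      using k by blast
  qed
  have "card (span (insert x B)) = card (UNIV \<times> span B :: ('a \<times> 'b) set)"
    using card_image[OF inj] img by simp
  also have "\<dots> = CARD('a) * CARD('a) ^ card B"
    using insert.IH[OF ind] by (simp add: card_cartesian_product)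
  finally show ?case using insert.hyps by simp
qed

lemma card_subspace:
  fixes V :: "('a::{field,finite} ^ 'n::finite) set"
  assumes "vec.subspace V"
  shows "card V = CARD('a) ^ vec.dim V"
proof -
  obtain B where B: "B \<subseteq> V" "vec.independent B" "V \<subseteq> vec.span B" "card B = vec.dim V"
    by (rule vec.basis_exists)
  have "vec.span B = V"
    using B assms by (meson vec.span_minimal subset_antisym)
  then show ?thesis
    using vec.card_span_independent[of B] B(2,4) by auto
qed

lemma two_le_card_field: "2 \<le> CARD('a::{field,finite})"
proof -
  have "card {0, 1 :: 'a} \<le> CARD('a)"
    by (rule card_mono) auto
  then show ?thesis by simp
qed

text \<open>Dimensions of graphs and of planes are found below by counting coefficient tuples
  instead of exhibiting a basis.\<close>

lemma dim_eq_if_card_subspace: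
  fixes V :: "('a::{field,finite} ^ 'n::finite) set"
  assumes "vec.subspace V" "card V = CARD('a) ^ d"
  shows "vec.dim V = d"
  using card_subspace[OF assms(1)] assms(2) two_le_card_field[where 'a='a]
  by (simp add: power_inject_exp)

lemma dim_subspace_sum:
  fixes V W :: "('a::field ^ 'n::finite) set"
  assumes "vec.subspace V" "vec.subspace W"
  shows "vec.dim (subspace_sum V W) + vec.dim (V \<inter> W) = vec.dim V + vec.dim W"
  using vec.dim_sums_Int[OF assms] by (simp add: subspace_sum_def)

lemma subspace_subspace_sum:
  fixes V W :: "('a::field ^ 'n::finite) set"
  assumes "vec.subspace V" "vec.subspace W"
  shows "vec.subspace (subspace_sum V W)"
  using vec.subspace_sums[OF assms] by (simp add: subspace_sum_def)

lemma subspace_sum_upper: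
  fixes V W :: "('a::field ^ 'n::finite) set"
  assumes "vec.subspace V" "vec.subspace W"
  shows "V \<subseteq> subspace_sum V W" "W \<subseteq> subspace_sum V W"
proof -
  show "V \<subseteq> subspace_sum V W"
    using vec.subspace_0[OF assms(2)] by (force simp: subspace_sum_def)
  show "W \<subseteq> subspace_sum V W"
    using vec.subspace_0[OF assms(1)] by (force simp: subspace_sum_def)
qed

lemma subspace_sum_least:
  fixes V W :: "('a::field ^ 'n::finite) set"
  assumes "vec.subspace U" "V \<subseteq> U" "W \<subseteq> U"
  shows "subspace_sum V W \<subseteq> U"
  using assms by (auto simp: subspace_sum_def intro: vec.subspace_add)

lemma dim_add_le_if_Int_trivial:
  fixes V W :: "('a::field ^ 'n::finite) set"
  assumes "vec.subspace V" "vec.subspace W" "V \<inter> W \<subseteq> {0}" "vec.subspace U" "V \<subseteq> U" "W \<subseteq> U"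
  shows "vec.dim V + vec.dim W \<le> vec.dim U"
proof -
  have "vec.dim (V \<inter> W) = 0"
    using assms(3) vec.dim_eq_0[of "V \<inter> W"] by blast
  then show ?thesis
    using dim_subspace_sum[OF assms(1,2)] vec.dim_subset[OF subspace_sum_least[OF assms(4,5,6)]]
    by linarith
qed

lemma dim_psubset_subspace:
  fixes V W :: "('a::field ^ 'n::finite) set"
  assumes "vec.subspace V" "vec.subspace W" "V \<subset> W"
  shows "vec.dim V < vec.dim W"
  using assms vec.dim_psubset[of V W] by (simp add: vec.span_eq_iff[THEN iffD2])

section \<open>Codes and the rank functions they define\<close>

text \<open>These are the constant-dimension codes of subspace distance at least 4; for
  \<open>r = 2\<close> they are the partial spreads. As in \<open>sparse_paving\<close>, the bound
  is additive because subtraction on nat truncates.\<close>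

definition codes :: "nat \<Rightarrow> ('a::field ^ 'n::finite) set set set" where
  "codes r = {C. (\<forall>V\<in>C. vec.subspace V \<and> vec.dim V = r) \<and>
     (\<forall>V\<in>C. \<forall>W\<in>C. V \<noteq> W \<longrightarrow> vec.dim (V \<inter> W) + 2 \<le> r)}"

lemma codesI:
  assumes "\<And>V. V \<in> C \<Longrightarrow> vec.subspace V" "\<And>V. V \<in> C \<Longrightarrow> vec.dim V = r"
    and "\<And>V W. V \<in> C \<Longrightarrow> W \<in> C \<Longrightarrow> V \<noteq> W \<Longrightarrow> vec.dim (V \<inter> W) + 2 \<le> r"
  shows "C \<in> codes r"
  using assms by (auto simp: codes_def)

lemma codesD:
  assumes "C \<in> codes r" "V \<in> C"
  shows "vec.subspace V" "vec.dim V = r"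
    and "W \<in> C \<Longrightarrow> V \<noteq> W \<Longrightarrow> vec.dim (V \<inter> W) + 2 \<le> r"
  using assms by (auto simp: codes_def)

lemma codes_subset: "C \<in> codes r \<Longrightarrow> D \<subseteq> C \<Longrightarrow> D \<in> codes r"
  by (rule codesI) (meson codesD subsetD)+

text \<open>The code \<^term>\<open>C\<close> becomes the set of circuits of dimension \<^term>\<open>r\<close>.\<close>
definition rank_of_code :: "nat \<Rightarrow> ('a::field ^ 'n::finite) set set \<Rightarrow> ('a ^ 'n) set \<Rightarrow> nat" where
  "rank_of_code r C =
     restrict (\<lambda>V. if V \<in> C then r - 1 else min (vec.dim V) r) (subspaces_of UNIV)"

lemma rank_of_code_apply:
  "vec.subspace V \<Longrightarrow> rank_of_code r C V = (if V \<in> C then r - 1 else min (vec.dim V) r)"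
  by (simp add: rank_of_code_def subspaces_of_def)

lemma rank_of_code_le_dim:
  "C \<in> codes r \<Longrightarrow> vec.subspace V \<Longrightarrow> rank_of_code r C V \<le> min (vec.dim V) r"
  by (auto simp: rank_of_code_apply dest: codesD)

text \<open>The value is lowered only at members of \<open>C\<close>, and only to
  \<open>r - 1\<close>; a proper subspace of a member has dimension at most \<open>r - 1\<close>
  anyway.\<close>

lemma rank_of_code_mono:
  assumes C: "C \<in> codes r" and VW: "vec.subspace V" "vec.subspace W" "V \<subseteq> W"
  shows "rank_of_code r C V \<le> rank_of_code r C W"
proof (cases "W \<in> C \<and> V \<noteq> W")
  case True
  then have "vec.dim V < r"
    using dim_psubset_subspace[of V W] codesD(2)[OF C] VW by auto
  then show ?thesis
    using True rank_of_code_le_dim[OF C VW(1)] by (simp add: rank_of_code_apply VW)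
next
  case False
  have "vec.dim V \<le> vec.dim W"
    using VW(3) by (rule vec.dim_subset)
  with False show ?thesis
    using rank_of_code_le_dim[OF C VW(1)] by (auto simp: rank_of_code_apply VW)
qed

text \<open>For incomparable \<open>V\<close> and \<open>W\<close>, the right side loses one unit
  for each of them that lies in \<open>C\<close>. One unit is regained because
  \<open>V \<inter> W\<close> has dimension below both \<open>r\<close> and \<open>dim W\<close>; if
  both lie in \<open>C\<close>, the second is regained from
  \<open>dim (V \<inter> W) \<le> r - 2\<close>.\<close>

lemma rank_of_code_submodular_aux:
  assumes C: "C \<in> codes r" and VW: "vec.subspace V" "vec.subspace W" and VC: "V \<in> C"
  shows "rank_of_code r C (subspace_sum V W) + rank_of_code r C (V \<inter> W)
    \<le> rank_of_code r C V + rank_of_code r C W"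
proof -
  have dV: "vec.dim V = r" using codesD(2)[OF C VC] .
  have subI: "vec.subspace (V \<inter> W)" using VW by (rule vec.subspace_inter)
  have subS: "vec.subspace (subspace_sum V W)" using VW by (rule subspace_subspace_sum)
  consider "V \<subseteq> W" | "W \<subset> V" | "\<not> V \<subseteq> W" "\<not> W \<subseteq> V" by auto
  then show ?thesis
  proof cases
    case 1
    then have "subspace_sum V W = W" "V \<inter> W = V"
      using subspace_sum_least[of W V W] subspace_sum_upper[of V W] VW by auto
    then show ?thesis by simp
  next
    case 2
    then have "subspace_sum V W = V" "V \<inter> W = W"
      using subspace_sum_least[of V V W] subspace_sum_upper[of V W] VW by auto
    then show ?thesis by simp
  next
    case 3
    have s: "rank_of_code r C (subspace_sum V W) \<le> r"
      and i: "rank_of_code r C (V \<inter> W) \<le> vec.dim (V \<inter> W)"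
      using rank_of_code_le_dim[OF C subS] rank_of_code_le_dim[OF C subI] by auto
    have dI: "vec.dim (V \<inter> W) < r" "vec.dim (V \<inter> W) < vec.dim W"
      using dim_psubset_subspace[OF subI VW(1)] dim_psubset_subspace[OF subI VW(2)] 3 dV by auto
    have rV: "rank_of_code r C V = r - 1"
      using VC by (simp add: rank_of_code_apply VW)
    show ?thesis
    proof (cases "W \<in> C")
      case True
      then have "vec.dim (V \<inter> W) + 2 \<le> r"
        using codesD(3)[OF C VC True] 3 by auto
      then show ?thesis
        using s i rV True by (simp add: rank_of_code_apply VW)
    next
      case False
      then have "rank_of_code r C W = min (vec.dim W) r"
        by (simp add: rank_of_code_apply VW)
      then show ?thesis
        using s i rV dI by linarith
    qed
  qed
qed

lemma rank_of_code_submodular: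
  assumes C: "C \<in> codes r" and VW: "vec.subspace V" "vec.subspace W"
  shows "rank_of_code r C (subspace_sum V W) + rank_of_code r C (V \<inter> W)
    \<le> rank_of_code r C V + rank_of_code r C W"
proof -
  have comm: "subspace_sum V W = subspace_sum W V"
    unfolding subspace_sum_def by (metis (no_types, opaque_lifting) add.commute)
  consider "V \<in> C" | "W \<in> C" | "V \<notin> C" "W \<notin> C" by auto
  then show ?thesis
  proof cases
    case 1
    then show ?thesis by (rule rank_of_code_submodular_aux[OF C VW])
  next
    case 2
    then show ?thesis
      using rank_of_code_submodular_aux[OF C VW(2,1)] by (simp add: comm Int_commute add.commute)
  next
    case 3
    have subI: "vec.subspace (V \<inter> W)" using VW by (rule vec.subspace_inter)
    have subS: "vec.subspace (subspace_sum V W)" using VW by (rule subspace_subspace_sum)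
    \<comment> \<open>Truncating the modular function dim at \<open>r\<close> leaves it submodular.
      If the sum or the intersection lies in \<open>C\<close>, the left side only becomes
      smaller.\<close>
    have "vec.dim (V \<inter> W) \<le> vec.dim V" "vec.dim (V \<inter> W) \<le> vec.dim W"
      by (auto intro: vec.dim_subset)
    then have "min (vec.dim (subspace_sum V W)) r + min (vec.dim (V \<inter> W)) r
        \<le> min (vec.dim V) r + min (vec.dim W) r"
      using dim_subspace_sum[OF VW] by linarith
    then show ?thesis
      using 3 add_mono[OF rank_of_code_le_dim[OF C subS] rank_of_code_le_dim[OF C subI]]
      by (simp add: rank_of_code_apply VW)
  qed
qed

lemma dependent_rank_of_code:
  assumes "C \<in> codes r" "0 < r" "dependent_space UNIV (rank_of_code r C) V"
  shows "V \<in> C \<or> r < vec.dim V"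
  using assms by (auto simp: dependent_space_def rank_of_code_apply subspaces_of_def split: if_splits)

text \<open>A code is recovered from its rank function as the set of \<open>r\<close>-dimensional
  subspaces of value \<open>r - 1\<close>, where \<open>0 < r\<close> separates \<open>r - 1\<close>
  from \<open>r\<close>. The hypothesis \<open>r < CARD('n)\<close> keeps the whole space out of the
  code, so that the rank is \<open>r\<close>.\<close>

lemma card_codes_le_num_sparse_paving:
  assumes "0 < r" "r < CARD('n::finite)"
  shows "card (codes r :: ('a::{field,finite} ^ 'n) set set set)
    \<le> num_sparse_paving TYPE('a ^ 'n) r"
  unfolding num_sparse_paving_def
proof (rule card_inj_on_le[where f = "rank_of_code r"])
  show "inj_on (rank_of_code r) (codes r :: ('a ^ 'n) set set set)"
  proof (rule inj_onI)
    fix C D :: "('a ^ 'n) set set"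
    assume C: "C \<in> codes r" and D: "D \<in> codes r" and eq: "rank_of_code r C = rank_of_code r D"
    have "V \<in> D" if "V \<in> C" "C \<in> codes r" "rank_of_code r C = rank_of_code r D"
      for C D :: "('a ^ 'n) set set" and V
    proof (rule ccontr)
      assume "V \<notin> D"
      then have "rank_of_code r C V = r - 1" "rank_of_code r D V = r"
        using codesD(1,2)[OF that(2,1)] that(1) by (simp_all add: rank_of_code_apply)
      then show False using that(3) assms(1) by simp
    qed
    from this[of _ C D] this[of _ D C] show "C = D"
      using C D eq by auto
  qed
next
  show "rank_of_code r ` (codes r :: ('a ^ 'n) set set set)
      \<subseteq> {\<rho>. q_matroid UNIV \<rho> \<and> \<rho> UNIV = r \<and> sparse_paving UNIV \<rho>}"
  proof (clarify, intro conjI)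
    fix C :: "('a ^ 'n) set set" assume C: "C \<in> codes r"
    show "q_matroid UNIV (rank_of_code r C)"
      using rank_of_code_le_dim[OF C] rank_of_code_mono[OF C] rank_of_code_submodular[OF C]
      by (auto simp: q_matroid_def subspaces_of_def[of UNIV] rank_of_code_def[unfolded subspaces_of_def])
    have "vec.dim (UNIV :: ('a ^ 'n) set) = CARD('n)"
      by (simp add: card_cart_basis)
    then show U: "rank_of_code r C UNIV = r"
      using assms(2) codesD(2)[OF C, of UNIV] by (auto simp: rank_of_code_apply)
    show "sparse_paving UNIV (rank_of_code r C)"
    proof -
      have *: "V \<in> C \<or> r < vec.dim V" if "circuit UNIV (rank_of_code r C) V" for V
        using dependent_rank_of_code[OF C assms(1)] that by (simp add: circuit_def)
      have "r \<le> vec.dim V" if "circuit UNIV (rank_of_code r C) V" for V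
        using *[OF that] codesD(2)[OF C] by auto
      moreover have "V \<in> C" if "circuit UNIV (rank_of_code r C) V" "vec.dim V = r" for V
        using *[OF that(1)] that(2) by simp
      ultimately show ?thesis
        using codesD(3)[OF C] unfolding sparse_paving_def paving_def U by blast
    qed
  qed
next
  \<comment> \<open>Extensionality and the bound by the dimension place all q-matroids in a finite
    function space, as the comparison of cardinalities requires.\<close>
  have "{\<rho> :: ('a ^ 'n) set \<Rightarrow> nat. q_matroid UNIV \<rho> \<and> \<rho> UNIV = r \<and> sparse_paving UNIV \<rho>}
      \<subseteq> PiE (subspaces_of UNIV) (\<lambda>V. {..vec.dim V})"
    by (auto simp: q_matroid_def PiE_def)
  then show "finite {\<rho> :: ('a ^ 'n) set \<Rightarrow> nat.
      q_matroid UNIV \<rho> \<and> \<rho> UNIV = r \<and> sparse_paving UNIV \<rho>}"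
    by (rule finite_subset) (auto intro!: finite_PiE)
qed

subsection \<open>Counting subsets of many codes\<close>

text \<open>Of a subset and its complement, at least one has more than \<open>k\<close>
  elements.\<close>

lemma card_large_subsets_half:
  assumes "finite A" "2 * k < card A"
  shows "2 ^ card A \<le> 2 * card {Z. Z \<subseteq> A \<and> k < card Z}"
proof -
  have fin: "finite {Z. Z \<subseteq> A \<and> k < card Z}"
    using assms(1) by simp
  have "Pow A \<subseteq> {Z. Z \<subseteq> A \<and> k < card Z} \<union> (\<lambda>Z. A - Z) ` {Z. Z \<subseteq> A \<and> k < card Z}"
  proof
    fix Z assume "Z \<in> Pow A"
    then have Z: "Z \<subseteq> A" by simp
    show "Z \<in> {Z. Z \<subseteq> A \<and> k < card Z} \<union> (\<lambda>Z. A - Z) ` {Z. Z \<subseteq> A \<and> k < card Z}"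
    proof (cases "k < card Z")
      case False
      have "card (A - Z) = card A - card Z"
        using Z assms(1) by (meson card_Diff_subset finite_subset)
      then have "A - Z \<in> {Z. Z \<subseteq> A \<and> k < card Z}"
        using False assms(2) by auto
      moreover have "Z = A - (A - Z)" using Z by auto
      ultimately show ?thesis by (intro UnI2 image_eqI)
    qed (use Z in simp)
  qed
  then have "card (Pow A) \<le> card ({Z. Z \<subseteq> A \<and> k < card Z} \<union> (\<lambda>Z. A - Z) ` {Z. Z \<subseteq> A \<and> k < card Z})"
    using fin by (intro card_mono) auto
  also have "\<dots> \<le> card {Z. Z \<subseteq> A \<and> k < card Z} + card {Z. Z \<subseteq> A \<and> k < card Z}"
    by (rule order_trans[OF card_Un_le add_left_mono[OF card_image_le[OF fin]]])
  finally show ?thesis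
    using assms(1) by (simp add: card_Pow)
qed

text \<open>This serves q = 2, where \<open>k\<close> is exactly half of \<open>card A\<close> and a
  subset and its complement may both have \<open>k\<close> elements. After removing one point
  \<open>a\<close>, at least half of the remaining subsets have at least \<open>k\<close> elements,
  and putting \<open>a\<close> back lifts them above \<open>k\<close>.\<close>

lemma card_large_subsets_quarter:
  assumes "finite A" "2 * k \<le> card A" "0 < k"
  shows "2 ^ card A \<le> 4 * card {Z. Z \<subseteq> A \<and> k < card Z}"
proof -
  have "A \<noteq> {}" using assms by auto
  then obtain a where a: "a \<in> A" by auto
  define B where "B = A - {a}"
  have A: "A = insert a B" "a \<notin> B" "finite B" using a assms(1) by (auto simp: B_def)
  then have cB: "card A = Suc (card B)" by simp
  have "2 * (k - 1) < card B" using assms(2,3) cB by simp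
  then have "2 ^ card B \<le> 2 * card {Z. Z \<subseteq> B \<and> k - 1 < card Z}"
    by (rule card_large_subsets_half[OF A(3)])
  also have "card {Z. Z \<subseteq> B \<and> k - 1 < card Z} \<le> card {Z. Z \<subseteq> A \<and> k < card Z}"
  proof (rule card_inj_on_le[where f = "insert a"])
    show "inj_on (insert a) {Z. Z \<subseteq> B \<and> k - 1 < card Z}"
      using A(2) by (intro inj_on_inverseI[where g = "\<lambda>Z. Z - {a}"]) auto
    show "insert a ` {Z. Z \<subseteq> B \<and> k - 1 < card Z} \<subseteq> {Z. Z \<subseteq> A \<and> k < card Z}"
    proof clarify
      fix Z assume Z: "Z \<subseteq> B" "k - 1 < card Z"
      then have "finite Z" "a \<notin> Z" using A(2,3) by (auto intro: finite_subset)
      then show "insert a Z \<subseteq> A \<and> k < card (insert a Z)"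
        using Z A(1) assms(3) by auto
    qed
  qed (use assms(1) in auto)
  finally show ?thesis unfolding cB by simp
qed

text \<open>Subsets with more than \<^term>\<open>k\<close> elements belong to only one of the sets \<^term>\<open>D j\<close>.\<close>
lemma card_family_large_subsets:
  assumes "finite J" "\<And>j. j \<in> J \<Longrightarrow> finite (D j)"
    and "\<And>i j. i \<in> J \<Longrightarrow> j \<in> J \<Longrightarrow> i \<noteq> j \<Longrightarrow> card (D i \<inter> D j) \<le> k"
    and "\<And>j. j \<in> J \<Longrightarrow> h \<le> card {Z. Z \<subseteq> D j \<and> k < card Z}"
    and "finite F" "\<And>j Z. j \<in> J \<Longrightarrow> Z \<subseteq> D j \<Longrightarrow> Z \<in> F"
  shows "card J * h \<le> card F"
proof -
  let ?P = "\<lambda>j. {Z. Z \<subseteq> D j \<and> k < card Z}"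
  have "card J * h \<le> (\<Sum>j\<in>J. card (?P j))"
    using sum_mono[of J "\<lambda>_. h" "\<lambda>j. card (?P j)"] assms(4) by simp
  also have "\<dots> = card (\<Union>j\<in>J. ?P j)"
  proof (rule card_UN_disjoint[symmetric])
    show "\<forall>i\<in>J. \<forall>j\<in>J. i \<noteq> j \<longrightarrow> ?P i \<inter> ?P j = {}"
    proof (intro ballI impI, rule ccontr)
      fix i j assume ij: "i \<in> J" "j \<in> J" "i \<noteq> j" "?P i \<inter> ?P j \<noteq> {}"
      from ij(4) obtain Z where Z: "Z \<subseteq> D i \<inter> D j" "k < card Z" by auto
      have "card Z \<le> card (D i \<inter> D j)"
        using Z(1) assms(2)[OF ij(1)] by (intro card_mono) auto
      then show False using assms(3)[OF ij(1-3)] Z(2) by simp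
    qed
  qed (use assms in auto)
  also have "\<dots> \<le> card F"
    using assms(5,6) by (intro card_mono) auto
  finally show ?thesis .
qed


section \<open>Complements of a subspace as graphs of linear maps\<close>

locale complementary_basis =
  fixes S :: "('a::{field,finite} ^ 'n::finite) set" and b :: "nat \<Rightarrow> 'a ^ 'n" and r :: nat
  assumes S: "vec.subspace S"
    and indep: "(\<Sum>i<r. c i *s b i) \<in> S \<Longrightarrow> i < r \<Longrightarrow> c i = 0"
begin

definition comb :: "(nat \<Rightarrow> 'a ^ 'n) \<Rightarrow> (nat \<Rightarrow> 'a) \<Rightarrow> 'a ^ 'n" where
  "comb v c = (\<Sum>i<r. c i *s (b i + v i))"

text \<open>The graph of the linear map that sends \<open>b i\<close> to \<open>v i\<close>: each
  element is a combination of the \<open>b i\<close> plus the image of that combination in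
  \<open>S\<close>.\<close>

definition graph :: "(nat \<Rightarrow> 'a ^ 'n) \<Rightarrow> ('a ^ 'n) set" where
  "graph v = range (comb v)"

lemma comb_add: "comb v c + comb v d = comb v (\<lambda>i. c i + d i)"
  by (simp add: comb_def sum.distrib vec.scale_left_distrib)

lemma comb_scale: "x *s comb v c = comb v (\<lambda>i. x * c i)"
  by (simp add: comb_def vec.scale_sum_right)

lemma comb_eq: "comb v c = (\<Sum>i<r. c i *s b i) + (\<Sum>i<r. c i *s v i)"
  by (simp add: comb_def sum.distrib vec.scale_right_distrib)

lemma sum_in_S: "v \<in> {..<r} \<rightarrow> S \<Longrightarrow> (\<Sum>i<r. c i *s v i) \<in> S"
  by (intro vec.subspace_sum[OF S] vec.subspace_scale[OF S]) (auto simp: Pi_iff)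

text \<open>Modulo \<open>S\<close> the tuples \<open>v\<close> and \<open>w\<close> disappear, so
  an element of a graph determines its coefficients by its class modulo \<open>S\<close>.
  Injectivity of \<open>comb\<close>, the trivial intersection with \<open>S\<close> and the
  intersection of two graphs all rest on this.\<close>

lemma comb_diff_in_S:
  assumes v: "v \<in> {..<r} \<rightarrow> S" and w: "w \<in> {..<r} \<rightarrow> S"
    and "comb v c - comb w d \<in> S" "i < r"
  shows "c i = d i"
proof -
  have "(\<Sum>i<r. (c i - d i) *s b i) =
      (comb v c - comb w d) - ((\<Sum>i<r. c i *s v i) - (\<Sum>i<r. d i *s w i))"
    by (simp add: comb_eq vec.scale_left_diff_distrib sum_subtractf)
  also have "\<dots> \<in> S"
    by (rule vec.subspace_diff[OF S assms(3) vec.subspace_diff[OF S sum_in_S[OF v] sum_in_S[OF w]]])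
  finally have "c i - d i = 0" using assms(4) by (rule indep)
  then show ?thesis by simp
qed

lemma comb_in_S:
  assumes v: "v \<in> {..<r} \<rightarrow> S" and "comb v c \<in> S"
  shows "comb v c = 0"
proof -
  have "comb v c - comb v (\<lambda>_. 0) \<in> S" using assms(2) by (simp add: comb_def)
  then have "\<And>i. i < r \<Longrightarrow> c i = 0"
    using comb_diff_in_S[OF v v, where d = "\<lambda>_. 0"] by simp
  then show ?thesis by (simp add: comb_def)
qed

lemma subspace_graph: "vec.subspace (graph v)"
  unfolding vec.subspace_def graph_def
proof (intro conjI ballI allI)
  show "0 \<in> range (comb v)"
    by (rule range_eqI[where x = "\<lambda>_. 0"]) (simp add: comb_def)
qed (auto simp: comb_add comb_scale)

lemma graph_Int_S:
  assumes v: "v \<in> {..<r} \<rightarrow> S"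
  shows "graph v \<inter> S = {0}"
  using comb_in_S[OF v] vec.subspace_0[OF subspace_graph[of v]] vec.subspace_0[OF S]
  by (auto simp: graph_def)

lemma dim_graph:
  assumes v: "v \<in> {..<r} \<rightarrow> S"
  shows "vec.dim (graph v) = r"
proof (rule dim_eq_if_card_subspace[OF subspace_graph])
  \<comment> \<open>Coefficients from index \<open>r\<close> on do not affect \<open>comb\<close>;
    fixing them there makes \<open>comb v\<close> injective.\<close>
  let ?P = "PiE {..<r} (\<lambda>_. UNIV) :: (nat \<Rightarrow> 'a) set"
  have "inj_on (comb v) ?P"
  proof (rule inj_onI)
    fix c d assume cd: "c \<in> ?P" "d \<in> ?P" "comb v c = comb v d"
    then have "comb v c - comb v d \<in> S" using vec.subspace_0[OF S] by simp
    then have "c i = d i" if "i < r" for i using comb_diff_in_S[OF v v _ that] by blast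
    then show "c = d" by (intro PiE_ext[OF cd(1,2)]) simp
  qed
  moreover have "comb v ` ?P = graph v"
  proof -
    have "comb v c \<in> comb v ` ?P" for c
      by (rule image_eqI[where x = "restrict c {..<r}"]) (auto simp: comb_def)
    then show ?thesis by (auto simp: graph_def)
  qed
  ultimately show "card (graph v) = CARD('a) ^ r"
    using card_image[of "comb v" ?P] by (simp add: card_PiE)
qed

text \<open>Common elements of two graphs correspond to linear relations between the differences
  \<open>v i - w i\<close>, so the codimension of the intersection in \<open>graph v\<close> is the
  rank of the difference.\<close>

lemma comb_in_graph_iff:
  assumes v: "v \<in> {..<r} \<rightarrow> S" and w: "w \<in> {..<r} \<rightarrow> S"
  shows "comb v c \<in> graph w \<longleftrightarrow> (\<Sum>i<r. c i *s (v i - w i)) = 0"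
proof
  assume "comb v c \<in> graph w"
  then obtain d where d: "comb v c = comb w d" by (auto simp: graph_def)
  then have "comb v c - comb w d \<in> S" using vec.subspace_0[OF S] by simp
  then have "\<And>i. i < r \<Longrightarrow> c i = d i" using comb_diff_in_S[OF v w] by blast
  then have "comb w d = comb w c" by (simp add: comb_def)
  then show "(\<Sum>i<r. c i *s (v i - w i)) = 0"
    using d by (simp add: comb_eq vec.scale_right_diff_distrib sum_subtractf)
next
  assume "(\<Sum>i<r. c i *s (v i - w i)) = 0"
  then have "comb v c = comb w c"
    by (simp add: comb_eq vec.scale_right_diff_distrib sum_subtractf)
  then show "comb v c \<in> graph w" by (simp add: graph_def)
qed

lemma graph_inj:
  assumes v: "v \<in> {..<r} \<rightarrow> S" and w: "w \<in> {..<r} \<rightarrow> S"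
    and "graph v = graph w" "i < r"
  shows "v i = w i"
proof -
  let ?c = "\<lambda>j. if j = i then 1 else 0"
  have "comb v ?c \<in> graph w" using assms(3) by (auto simp: graph_def)
  then have "(\<Sum>j<r. ?c j *s (v j - w j)) = 0"
    using comb_in_graph_iff[OF v w] by simp
  also have "(\<Sum>j<r. ?c j *s (v j - w j)) = (\<Sum>j<r. if j = i then v j - w j else 0)"
    by (rule sum.cong) auto
  also have "\<dots> = v i - w i" using assms(4) by simp
  finally show ?thesis by simp
qed

text \<open>Two independent rows of the difference span a plane in \<^term>\<open>graph v\<close> that meets
  \<^term>\<open>graph w\<close> trivially.\<close>
lemma dim_graph_Int_graph:
  assumes v: "v \<in> {..<r} \<rightarrow> S" and w: "w \<in> {..<r} \<rightarrow> S"
    and ij: "i < r" "j < r"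
    and ind: "\<And>x y. x *s (v i - w i) + y *s (v j - w j) = 0 \<Longrightarrow> x = 0 \<and> y = 0"
  shows "vec.dim (graph v \<inter> graph w) + 2 \<le> r"
proof -
  have "i \<noteq> j" using ind[of 1 "- 1"] by auto
  define f where "f = (\<lambda>(x, y) k. if k = i then x else if k = j then y else 0 :: 'a)"
  define L where "L = range (\<lambda>p. comb v (f p))"
  have sum_f: "(\<Sum>k<r. f (x, y) k *s d k) = x *s d i + y *s d j" for x y and d :: "nat \<Rightarrow> 'a ^ 'n"
  proof -
    have "(\<Sum>k<r. f (x, y) k *s d k)
        = (\<Sum>k<r. (if k = i then x *s d k else 0) + (if k = j then y *s d k else 0))"
      using \<open>i \<noteq> j\<close> by (intro sum.cong) (auto simp: f_def)
    also have "\<dots> = x *s d i + y *s d j" using ij by (simp add: sum.distrib)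
    finally show ?thesis .
  qed
  have comb_f: "comb v (f (x, y)) = x *s (b i + v i) + y *s (b j + v j)" for x y
    unfolding comb_def by (rule sum_f)
  have L: "vec.subspace L"
    unfolding vec.subspace_def L_def
  proof (intro conjI ballI allI)
    show "0 \<in> range (\<lambda>p. comb v (f p))"
      by (rule range_eqI[where x = "(0, 0)"]) (simp add: comb_f)
  next
    fix x y assume "x \<in> range (\<lambda>p. comb v (f p))" "y \<in> range (\<lambda>p. comb v (f p))"
    then obtain p p' q q' where "x = comb v (f (p, p'))" "y = comb v (f (q, q'))" by auto
    then have "x + y = comb v (f (p + q, p' + q'))"
      by (simp add: comb_f vector_sadd_rdistrib algebra_simps)
    then show "x + y \<in> range (\<lambda>p. comb v (f p))" by blast
  next
    fix c x assume "x \<in> range (\<lambda>p. comb v (f p))"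
    then obtain p p' where "x = comb v (f (p, p'))" by auto
    then have "c *s x = comb v (f (c * p, c * p'))"
      by (simp add: comb_f vector_add_ldistrib vector_smult_assoc)
    then show "c *s x \<in> range (\<lambda>p. comb v (f p))" by blast
  qed
  have "inj (\<lambda>p. comb v (f p))"
  proof (rule injI)
    fix p q assume "comb v (f p) = comb v (f q)"
    then have "comb v (f p) - comb v (f q) \<in> S" using vec.subspace_0[OF S] by simp
    then have "f p i = f q i" "f p j = f q j" using comb_diff_in_S[OF v v] ij by blast+
    then show "p = q" using \<open>i \<noteq> j\<close> by (cases p, cases q) (auto simp: f_def)
  qed
  then have "card L = CARD('a \<times> 'a)" by (simp add: L_def card_image)
  then have "vec.dim L = 2"
    using dim_eq_if_card_subspace[OF L] by (simp add: power2_eq_square)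
  moreover have "L \<inter> (graph v \<inter> graph w) \<subseteq> {0}"
  proof
    fix z assume z: "z \<in> L \<inter> (graph v \<inter> graph w)"
    then obtain x y where xy: "z = comb v (f (x, y))" by (auto simp: L_def)
    with z have "(\<Sum>k<r. f (x, y) k *s (v k - w k)) = 0"
      using comb_in_graph_iff[OF v w] by auto
    then have "x = 0 \<and> y = 0" unfolding sum_f by (rule ind)
    then show "z \<in> {0}" using xy by (simp add: comb_f)
  qed
  moreover have "L \<subseteq> graph v" by (auto simp: L_def graph_def)
  ultimately show ?thesis
    using dim_add_le_if_Int_trivial[OF L vec.subspace_inter[OF subspace_graph subspace_graph] _
        subspace_graph, of v w v] dim_graph[OF v] by auto
qed

end

section \<open>Codes from systems of injective operators\<close>

text \<open>\<open>B i k\<close> is the operator number \<open>k\<close> of system \<open>i\<close>,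
  constrained only on \<open>S\<close>. \<open>regular\<close> says that a combination with some
  nonzero coefficient below \<open>r\<close> kills no nonzero vector of \<open>S\<close>.
  \<open>distinct\<close> looks at operator 1 alone, since moving the row \<open>v 1\<close> is
  enough to bound the overlap of two codes. The index type is a parameter because the two
  constructions below index by different data.\<close>

locale operator_system = complementary_basis S b r
  for S :: "('a::{field,finite} ^ 'n::finite) set" and b r +
  fixes I :: "'i set" and B :: "'i \<Rightarrow> nat \<Rightarrow> 'a ^ 'n \<Rightarrow> 'a ^ 'n"
  assumes r: "2 \<le> r" and I: "finite I" and dim_S: "vec.dim S \<noteq> 0"
    and B_closed: "i \<in> I \<Longrightarrow> k < r \<Longrightarrow> x \<in> S \<Longrightarrow> B i k x \<in> S"
    and B_add: "i \<in> I \<Longrightarrow> k < r \<Longrightarrow> x \<in> S \<Longrightarrow> y \<in> S \<Longrightarrow> B i k (x + y) = B i k x + B i k y"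
    and B_scale: "i \<in> I \<Longrightarrow> k < r \<Longrightarrow> x \<in> S \<Longrightarrow> B i k (a *s x) = a *s B i k x"
    and B_0: "i \<in> I \<Longrightarrow> x \<in> S \<Longrightarrow> B i 0 x = x"
    and regular: "i \<in> I \<Longrightarrow> x \<in> S \<Longrightarrow> x \<noteq> 0 \<Longrightarrow> (\<Sum>k<r. c k *s B i k x) = 0 \<Longrightarrow> k < r \<Longrightarrow> c k = 0"
    and distinct: "i \<in> I \<Longrightarrow> j \<in> I \<Longrightarrow> i \<noteq> j \<Longrightarrow> \<exists>x\<in>S. B i 1 x \<noteq> B j 1 x"
begin

lemma B_diff:
  assumes "i \<in> I" "k < r" "x \<in> S" "y \<in> S"
  shows "B i k (x - y) = B i k x - B i k y"
proof -
  have "B i k ((x - y) + y) = B i k (x - y) + B i k y"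
    using assms by (intro B_add vec.subspace_diff[OF S])
  then show ?thesis by simp
qed

definition rows :: "(nat \<Rightarrow> 'a ^ 'n) set" where
  "rows = PiE {1..<r} (\<lambda>_. S)"

definition lift_rows :: "'i \<times> ('a ^ 'n) \<Rightarrow> (nat \<Rightarrow> 'a ^ 'n) \<Rightarrow> nat \<Rightarrow> 'a ^ 'n" where
  "lift_rows = (\<lambda>(i, w) v k. if k = 0 then w + (\<Sum>l=1..<r. B i l (v l)) else v k)"

definition code :: "'i \<times> ('a ^ 'n) \<Rightarrow> ('a ^ 'n) set set" where
  "code j = (\<lambda>v. graph (lift_rows j v)) ` rows"

lemma rowsD: "v \<in> rows \<Longrightarrow> k \<in> {1..<r} \<Longrightarrow> v k \<in> S"
  by (auto simp: rows_def)

lemma lift_rows_in: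
  assumes "j \<in> I \<times> S" "v \<in> rows"
  shows "lift_rows j v \<in> {..<r} \<rightarrow> S"
proof -
  obtain i w where j: "j = (i, w)" "i \<in> I" "w \<in> S" using assms(1) by auto
  have "(\<Sum>l=1..<r. B i l (v l)) \<in> S"
    using rowsD[OF assms(2)] j by (intro vec.subspace_sum[OF S] B_closed) auto
  then show ?thesis
    using rowsD[OF assms(2)] j r by (auto simp: lift_rows_def intro: vec.subspace_add[OF S])
qed

lemma rows_eqI:
  assumes "v \<in> rows" "v' \<in> rows" "\<And>k. k \<in> {1..<r} \<Longrightarrow> v k = v' k"
  shows "v = v'"
  using assms unfolding rows_def by (rule PiE_ext)

lemma graph_lift_rows_eq:
  assumes j: "j \<in> I \<times> S" "v \<in> rows" and j': "j' \<in> I \<times> S" "v' \<in> rows"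
    and eq: "graph (lift_rows j v) = graph (lift_rows j' v')"
  shows "v = v'" "lift_rows j v 0 = lift_rows j' v' 0"
proof -
  have *: "lift_rows j v k = lift_rows j' v' k" if "k < r" for k
    using graph_inj[OF lift_rows_in[OF j] lift_rows_in[OF j'] eq that] .
  show "lift_rows j v 0 = lift_rows j' v' 0" using *[of 0] r by simp
  show "v = v'"
  proof (rule rows_eqI[OF j(2) j'(2)])
    fix k assume "k \<in> {1..<r}"
    then show "v k = v' k" using *[of k] by (auto simp: lift_rows_def split_beta)
  qed
qed

lemma finite_rows: "finite rows"
  by (auto simp: rows_def intro: finite_PiE)

lemma card_rows: "card rows = CARD('a) ^ (vec.dim S * (r - 1))"
  by (simp add: rows_def card_PiE card_subspace[OF S] power_mult)

lemma finite_code: "finite (code j)"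
  using finite_rows by (simp add: code_def)

lemma card_code:
  assumes "j \<in> I \<times> S"
  shows "card (code j) = CARD('a) ^ (vec.dim S * (r - 1))"
proof -
  have "inj_on (\<lambda>v. graph (lift_rows j v)) rows"
    using graph_lift_rows_eq(1)[OF assms _ assms] by (auto intro: inj_onI)
  then show ?thesis by (simp add: code_def card_image card_rows)
qed

text \<open>If no two rows of the difference \<^term>\<open>d\<close> are independent, it has the form \<^term>\<open>d k = c k *s u\<close>,
  and the equation defining the code contradicts regularity.\<close>
lemma code_in_codes:
  assumes j: "j \<in> I \<times> S"
  shows "code j \<in> codes r"
proof (rule codesI)
  fix V assume "V \<in> code j"
  then obtain v where v: "v \<in> rows" "V = graph (lift_rows j v)" by (auto simp: code_def)
  show "vec.subspace V" "vec.dim V = r"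
    using subspace_graph dim_graph[OF lift_rows_in[OF j v(1)]] v(2) by auto
next
  fix V W assume VW: "V \<in> code j" "W \<in> code j" "V \<noteq> W"
  obtain v where v: "v \<in> rows" "V = graph (lift_rows j v)" using VW by (auto simp: code_def)
  obtain w where w: "w \<in> rows" "W = graph (lift_rows j w)" using VW by (auto simp: code_def)
  obtain i z where iz: "j = (i, z)" "i \<in> I" "z \<in> S" using j by auto
  let ?d = "\<lambda>k. lift_rows j v k - lift_rows j w k"
  have dS: "?d k \<in> S" if "k < r" for k
    using lift_rows_in[OF j v(1)] lift_rows_in[OF j w(1)] that
    by (auto intro: vec.subspace_diff[OF S])
  have d0: "?d 0 = (\<Sum>l=1..<r. B i l (?d l))"
  proof -
    have "?d 0 = (\<Sum>l=1..<r. B i l (v l)) - (\<Sum>l=1..<r. B i l (w l))"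
      by (simp add: lift_rows_def iz)
    also have "\<dots> = (\<Sum>l=1..<r. B i l (v l) - B i l (w l))"
      by (simp add: sum_subtractf)
    also have "\<dots> = (\<Sum>l=1..<r. B i l (?d l))"
      using rowsD[OF v(1)] rowsD[OF w(1)] iz
      by (intro sum.cong) (auto simp: lift_rows_def B_diff)
    finally show ?thesis .
  qed
  obtain p where p: "p < r" "?d p \<noteq> 0"
  proof -
    obtain k where "k \<in> {1..<r}" "v k \<noteq> w k"
      using VW(3) v(2) w(2) rows_eqI[OF v(1) w(1)] by auto
    then show ?thesis using that[of k] by (auto simp: lift_rows_def iz)
  qed
  show "vec.dim (V \<inter> W) + 2 \<le> r"
  proof (cases "\<exists>k<r. \<forall>x y. x *s ?d p + y *s ?d k = 0 \<longrightarrow> x = 0 \<and> y = 0")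
    case True
    then show ?thesis
      using dim_graph_Int_graph[OF lift_rows_in[OF j v(1)] lift_rows_in[OF j w(1)] p(1)] v w
      by blast
  next
    case False
    have "\<exists>c. ?d k = c *s ?d p" if k: "k < r" for k
    proof -
      obtain x y where xy: "x *s ?d p + y *s ?d k = 0" "\<not> (x = 0 \<and> y = 0)"
        using False k by blast
      have "y \<noteq> 0"
      proof
        assume "y = 0"
        with xy(1) have "x *s ?d p = 0" by simp
        with p(2) have "x = 0" by (simp only: vec.scale_eq_0_iff) simp
        with \<open>y = 0\<close> xy(2) show False by simp
      qed
      have "y *s ?d k = (- x) *s ?d p"
        using xy(1) by (simp only: vec.scale_minus_left eq_neg_iff_add_eq_0 add.commute)
      then have "inverse y *s (y *s ?d k) = inverse y *s ((- x) *s ?d p)" by simp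
      then have "?d k = (inverse y * (- x)) *s ?d p"
        using \<open>y \<noteq> 0\<close> by (simp only: vector_smult_assoc) simp
      then show ?thesis by blast
    qed
    then have "\<forall>k. \<exists>c. k < r \<longrightarrow> ?d k = c *s ?d p" by simp
    then obtain c where "\<forall>k. k < r \<longrightarrow> ?d k = c k *s ?d p" unfolding choice_iff by (elim exE)
    then have c: "?d k = c k *s ?d p" if "k < r" for k using that by simp
    \<comment> \<open>The sign changes at 0 only: the equation for row 0 is moved to one side, where
      row 0 appears through \<open>B i 0\<close>, the identity.\<close>
    define e where "e k = (if k = 0 then - c 0 else c k)" for k
    have "{..<r} = insert 0 {1..<r}" using r by auto
    then have "(\<Sum>k<r. e k *s B i k (?d p)) = e 0 *s B i 0 (?d p) + (\<Sum>k=1..<r. e k *s B i k (?d p))"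
      by simp
    also have "e 0 *s B i 0 (?d p) = - ?d 0"
      using c[of 0] r B_0[OF iz(2) dS[OF p(1)]] by (simp add: e_def)
    also have "(\<Sum>k=1..<r. e k *s B i k (?d p)) = (\<Sum>k=1..<r. B i k (?d k))"
    proof (rule sum.cong)
      fix k assume k: "k \<in> {1..<r}"
      then have "B i k (?d k) = B i k (c k *s ?d p)" using c[of k] by simp
      also have "\<dots> = c k *s B i k (?d p)" using k dS[OF p(1)] iz by (intro B_scale) auto
      finally show "e k *s B i k (?d p) = B i k (?d k)" using k by (simp add: e_def)
    qed simp
    also have "- ?d 0 + \<dots> = 0" unfolding d0 by simp
    finally have "e p = 0" using regular[OF iz(2) dS[OF p(1)] p(2)] p(1) by blast
    then have "?d p = 0" using c[OF p(1)] by (auto simp: e_def split: if_splits)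
    then show ?thesis using p(2) by contradiction
  qed
qed

text \<open>A graph determines its rows, so a common member comes from a \<open>v\<close> for which
  both formulas give the same row 0. For equal systems and different translations there is none. For
  different systems this is a proper affine condition on \<open>v 1\<close>, which holds for at most
  a fraction 1/q of all \<open>v\<close>.\<close>

lemma card_code_Int:
  assumes j: "j \<in> I \<times> S" "j' \<in> I \<times> S" "j \<noteq> j'"
  shows "CARD('a) * card (code j \<inter> code j') \<le> CARD('a) ^ (vec.dim S * (r - 1))"
proof -
  obtain i w where iw: "j = (i, w)" "i \<in> I" "w \<in> S" using j by auto
  obtain i' w' where iw': "j' = (i', w')" "i' \<in> I" "w' \<in> S" using j by auto
  define sol where "sol = {v \<in> rows. lift_rows j v 0 = lift_rows j' v 0}"
  have fin: "finite sol" using finite_rows by (simp add: sol_def)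
  have "code j \<inter> code j' \<subseteq> (\<lambda>v. graph (lift_rows j v)) ` sol"
  proof
    fix V assume "V \<in> code j \<inter> code j'"
    then obtain v v' where v: "v \<in> rows" "V = graph (lift_rows j v)"
      and v': "v' \<in> rows" "V = graph (lift_rows j' v')" by (auto simp: code_def)
    then have "v = v'" "lift_rows j v 0 = lift_rows j' v' 0"
      using graph_lift_rows_eq[OF j(1) v(1) j(2) v'(1)] by auto
    then show "V \<in> (\<lambda>v. graph (lift_rows j v)) ` sol"
      using v by (auto simp: sol_def)
  qed
  then have le: "card (code j \<inter> code j') \<le> card sol"
    using fin by (meson card_image_le card_mono finite_imageI le_trans)
  have "CARD('a) * card sol \<le> card rows"
  proof (cases "i = i'")
    case True
    then have "sol = {}" using iw iw' j(3) by (auto simp: sol_def lift_rows_def)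
    then show ?thesis by simp
  next
    case False
    then obtain x where x: "x \<in> S" "B i 1 x \<noteq> B i' 1 x" using distinct iw iw' by blast
    \<comment> \<open>Moving \<open>v 1\<close> by multiples of a vector \<open>x\<close> on which
      the two operators disagree turns \<open>sol\<close> into q disjoint translates inside
      \<open>rows\<close>: two solutions on such a line through \<open>x\<close> would force the
      operators to agree on \<open>x\<close>.\<close>
    define f where "f = (\<lambda>(c, v :: nat \<Rightarrow> 'a ^ 'n). v(1 := v 1 + c *s x))"
    have "card (UNIV \<times> sol :: ('a \<times> (nat \<Rightarrow> 'a ^ 'n)) set) \<le> card rows"
    proof (rule card_inj_on_le[where f = f])
      show "f ` (UNIV \<times> sol) \<subseteq> rows"
        using x r by (auto simp: f_def sol_def rows_def PiE_iff extensional_def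
            intro!: vec.subspace_add[OF S] vec.subspace_scale[OF S])
      show "inj_on f (UNIV \<times> sol)"
      proof (rule inj_onI, clarsimp simp: f_def)
        fix c v c' v'
        assume v: "v \<in> sol" "v' \<in> sol"
          and eq: "v(Suc 0 := v (Suc 0) + c *s x) = v'(Suc 0 := v' (Suc 0) + c' *s x)"
        have off: "v k = v' k" if "k \<noteq> 1" for k
          using fun_cong[OF eq, of k] that by simp
        have at1: "v 1 = v' 1 + (c' - c) *s x"
          using fun_cong[OF eq, of 1] by (simp add: vec.scale_left_diff_distrib algebra_simps)
        have in_S: "v 1 \<in> S" "v' 1 \<in> S" using v r rowsD by (auto simp: sol_def)
        have split: "(\<Sum>l=1..<r. g l) = g 1 + (\<Sum>l=2..<r. g l)" for g :: "nat \<Rightarrow> 'a ^ 'n"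
          using r by (simp add: sum.atLeast_Suc_lessThan numeral_2_eq_2)
        have key: "w + (B i 1 (u 1) + (\<Sum>l=2..<r. B i l (u l))) =
            w' + (B i' 1 (u 1) + (\<Sum>l=2..<r. B i' l (u l)))" if "u \<in> sol" for u
          using that unfolding sol_def lift_rows_def iw iw' by (simp add: split[simplified])
        have tail: "(\<Sum>l=2..<r. B i l (v l)) = (\<Sum>l=2..<r. B i l (v' l))"
          "(\<Sum>l=2..<r. B i' l (v l)) = (\<Sum>l=2..<r. B i' l (v' l))"
          using off by auto
        have "w + (B i 1 (v 1) + (\<Sum>l=2..<r. B i l (v l))) -
            (w + (B i 1 (v' 1) + (\<Sum>l=2..<r. B i l (v' l)))) =
            w' + (B i' 1 (v 1) + (\<Sum>l=2..<r. B i' l (v l))) -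
            (w' + (B i' 1 (v' 1) + (\<Sum>l=2..<r. B i' l (v' l))))"
          by (simp only: key[OF v(1)] key[OF v(2)])
        then have "B i 1 (v 1) - B i 1 (v' 1) = B i' 1 (v 1) - B i' 1 (v' 1)"
          unfolding tail by simp
        moreover have "B k 1 (v 1) - B k 1 (v' 1) = (c' - c) *s B k 1 x" if "k \<in> I" for k
        proof -
          have "B k 1 (v 1) = B k 1 (v' 1) + B k 1 ((c' - c) *s x)"
            unfolding at1 using that in_S(2) x(1) r by (intro B_add vec.subspace_scale[OF S]) auto
          moreover have "B k 1 ((c' - c) *s x) = (c' - c) *s B k 1 x"
            using that x(1) r by (intro B_scale) auto
          ultimately show ?thesis by simp
        qed
        ultimately have "(c' - c) *s (B i 1 x - B i' 1 x) = 0"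
          using iw iw' by (simp add: vec.scale_right_diff_distrib)
        then have "c = c'" using x(2) by (simp only: vec.scale_eq_0_iff) simp
        moreover have "v k = v' k" for k using off[of k] at1 \<open>c = c'\<close> by (cases "k = 1") auto
        ultimately show "c = c' \<and> v = v'" by auto
      qed
    qed (rule finite_rows)
    then show ?thesis by (simp add: card_cartesian_product)
  qed
  then show ?thesis
    using order_trans[OF mult_le_mono2[OF le]] card_rows by simp
qed

definition avoiding :: "('a ^ 'n) set set set" where
  "avoiding = {Z \<in> codes r. \<forall>V\<in>Z. V \<inter> S = {0}}"

text \<open>\<open>h\<close> stands for the guaranteed number of large subsets of a single code,
  later a quarter or a half of all subsets. The threshold is the code size divided by q, the overlap
  bound of two codes.\<close>

lemma card_avoiding_aux:
  assumes "\<And>A :: ('a ^ 'n) set set. card A = CARD('a) ^ (vec.dim S * (r - 1)) \<Longrightarrow>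
      h \<le> card {Z. Z \<subseteq> A \<and> CARD('a) ^ (vec.dim S * (r - 1) - 1) < card Z}"
  shows "card I * CARD('a) ^ vec.dim S * h \<le> card avoiding"
proof -
  let ?N = "vec.dim S * (r - 1)"
  have N: "CARD('a) ^ ?N = CARD('a) * CARD('a) ^ (?N - 1)"
    using dim_S r by (intro power_eq_if[THEN trans]) auto
  have "card (I \<times> S) * h \<le> card avoiding"
  proof (rule card_family_large_subsets[where D = code and k = "CARD('a) ^ (?N - 1)"])
    fix j j' assume "j \<in> I \<times> S" "j' \<in> I \<times> S" "j \<noteq> j'"
    then show "card (code j \<inter> code j') \<le> CARD('a) ^ (?N - 1)"
      using card_code_Int[of j j'] unfolding N by simp
  next
    fix j Z assume j: "j \<in> I \<times> S" and Z: "Z \<subseteq> code j"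
    have "V \<inter> S = {0}" if "V \<in> code j" for V
      using that graph_Int_S lift_rows_in[OF j] by (auto simp: code_def)
    then show "Z \<in> avoiding"
      using Z codes_subset[OF code_in_codes[OF j] Z] by (auto simp: avoiding_def)
  qed (use I assms card_code finite_code in auto)
  then show ?thesis by (simp add: card_cartesian_product card_subspace[OF S])
qed

lemma card_avoiding:
  shows "card I * CARD('a) ^ vec.dim S * 2 ^ CARD('a) ^ (vec.dim S * (r - 1)) \<le> 4 * card avoiding"
    and "3 \<le> CARD('a) \<Longrightarrow>
      card I * CARD('a) ^ vec.dim S * 2 ^ CARD('a) ^ (vec.dim S * (r - 1)) \<le> 2 * card avoiding"
proof -
  let ?N = "vec.dim S * (r - 1)" and ?q = "CARD('a)"
  have q: "2 \<le> ?q" by (rule two_le_card_field)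
  have N: "?q ^ ?N = ?q * ?q ^ (?N - 1)"
    using dim_S r by (intro power_eq_if[THEN trans]) auto
  \<comment> \<open>The share \<open>h\<close> is written with \<open>div\<close>; divisibility
    makes it exact.\<close>
  have dvd: "(4::nat) dvd 2 ^ ?q ^ ?N" "(2::nat) dvd 2 ^ ?q ^ ?N"
  proof -
    have "2 \<le> ?q ^ ?N" using q mult_le_mono[of 2 ?q 1 "?q ^ (?N - 1)"] unfolding N by simp
    then have "(2::nat) ^ 2 dvd 2 ^ ?q ^ ?N" by (rule le_imp_power_dvd)
    then show "(4::nat) dvd 2 ^ ?q ^ ?N" by simp
    then show "(2::nat) dvd 2 ^ ?q ^ ?N" by (rule dvd_trans[rotated]) simp
  qed
  have "card I * ?q ^ vec.dim S * (2 ^ ?q ^ ?N div 4) \<le> card avoiding"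
  proof (rule card_avoiding_aux)
    fix A :: "('a ^ 'n) set set" assume A: "card A = ?q ^ ?N"
    have "2 ^ card A \<le> 4 * card {Z. Z \<subseteq> A \<and> ?q ^ (?N - 1) < card Z}"
    proof (rule card_large_subsets_quarter)
      show "finite A" using A q by (intro card_ge_0_finite) simp
      show "2 * ?q ^ (?N - 1) \<le> card A" unfolding A N using q by (intro mult_le_mono1)
    qed (use q in simp)
    then show "2 ^ ?q ^ ?N div 4 \<le> card {Z. Z \<subseteq> A \<and> ?q ^ (?N - 1) < card Z}"
      unfolding A by linarith
  qed
  then show "card I * ?q ^ vec.dim S * 2 ^ ?q ^ ?N \<le> 4 * card avoiding"
    using dvd(1) by (elim dvdE) simp
  assume q3: "3 \<le> ?q"
  have "card I * ?q ^ vec.dim S * (2 ^ ?q ^ ?N div 2) \<le> card avoiding"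
  proof (rule card_avoiding_aux)
    fix A :: "('a ^ 'n) set set" assume A: "card A = ?q ^ ?N"
    have "2 ^ card A \<le> 2 * card {Z. Z \<subseteq> A \<and> ?q ^ (?N - 1) < card Z}"
    proof (rule card_large_subsets_half)
      show "finite A" using A q by (intro card_ge_0_finite) simp
      show "2 * ?q ^ (?N - 1) < card A" unfolding A N using q3 by (intro mult_less_mono1) auto
    qed
    then show "2 ^ ?q ^ ?N div 2 \<le> card {Z. Z \<subseteq> A \<and> ?q ^ (?N - 1) < card Z}"
      unfolding A by linarith
  qed
  then show "card I * ?q ^ vec.dim S * 2 ^ ?q ^ ?N \<le> 2 * card avoiding"
    using dvd(2) by (elim dvdE) simp
qed

end

subsection \<open>Changing the avoided subspace\<close>

lemma ex_subspace_between:
  fixes W :: "('a::field ^ 'n::finite) set"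
  assumes W: "vec.subspace W" and m: "vec.dim W \<le> m" "m \<le> CARD('n)"
  shows "\<exists>S. vec.subspace S \<and> vec.dim S = m \<and> W \<subseteq> S"
proof -
  obtain B where B: "B \<subseteq> W" "vec.independent B" "W \<subseteq> vec.span B" "card B = vec.dim W"
    by (rule vec.basis_exists)
  obtain C where C: "B \<subseteq> C" "vec.independent C" "UNIV \<subseteq> vec.span C"
    using vec.maximal_independent_subset_extend[OF subset_UNIV B(2)] by auto
  have finC: "finite C" using C(2) by (rule vec.finiteI_independent)
  have "card C = CARD('n)"
    using vec.basis_card_eq_dim[OF subset_UNIV C(3,2)] by (simp add: card_cart_basis)
  then obtain D where D: "B \<subseteq> D" "D \<subseteq> C" "card D = m"
    using exists_subset_between[of B m C] B(4) m C(1) finC by auto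
  have "vec.independent D" using C(2) D(2) by (rule vec.independent_mono)
  then have "vec.dim (vec.span D) = m"
    using vec.dim_span_eq_card_independent[of D] D(3) by simp
  moreover have "W \<subseteq> vec.span D" using B(3) vec.span_mono[OF D(1)] by auto
  ultimately show ?thesis using vec.subspace_span by blast
qed

lemma ex_complementary_basis:
  fixes S :: "('a::{field,finite} ^ 'n::finite) set"
  assumes S: "vec.subspace S" and dim: "vec.dim S + r = CARD('n)"
  shows "\<exists>b. complementary_basis S b r"
proof -
  obtain B where B: "B \<subseteq> S" "vec.independent B" "S \<subseteq> vec.span B" "card B = vec.dim S"
    by (rule vec.basis_exists)
  have SB: "S = vec.span B" using B(1,3) S by (intro subset_antisym vec.span_minimal)
  obtain C where C: "B \<subseteq> C" "vec.independent C" "UNIV \<subseteq> vec.span C"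
    using vec.maximal_independent_subset_extend[OF subset_UNIV B(2)] by auto
  have finC: "finite C" using C(2) by (rule vec.finiteI_independent)
  then have finB: "finite B" using C(1) by (rule finite_subset[rotated])
  have "card C = CARD('n)"
    using vec.basis_card_eq_dim[OF subset_UNIV C(3,2)] by (simp add: card_cart_basis)
  then have "card (C - B) = r"
    using card_Diff_subset[OF finB C(1)] B(4) dim by simp
  then obtain b where b: "bij_betw b {..<r} (C - B)"
    using finC by (metis bij_betw_iff_card card_lessThan finite_Diff finite_lessThan)
  have "complementary_basis S b r"
  proof
    fix c i assume in_S: "(\<Sum>i<r. c i *s b i) \<in> S" and i: "i < r"
    define g where "g = (\<lambda>x. c (inv_into {..<r} b x))"
    have g: "g (b i) = c i" if "i < r" for i
      using that b by (simp add: g_def bij_betw_def)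
    have "(\<Sum>i<r. c i *s b i) = (\<Sum>i<r. g (b i) *s b i)"
      by (intro sum.cong) (auto simp: g)
    also have "\<dots> = (\<Sum>x\<in>C - B. g x *s x)"
      using sum.reindex_bij_betw[OF b, of "\<lambda>x. g x *s x"] .
    finally have sum_g: "(\<Sum>i<r. c i *s b i) = (\<Sum>x\<in>C - B. g x *s x)" .
    obtain h where h: "(\<Sum>i<r. c i *s b i) = (\<Sum>x\<in>B. h x *s x)"
      using in_S unfolding SB vec.span_finite[OF finB] by auto
    \<comment> \<open>The vector in \<open>S\<close> is expanded over \<open>B\<close> as well;
      subtracting the two expansions gives a relation in the basis \<open>C\<close>.\<close>
    define u where "u = (\<lambda>x. if x \<in> B then - h x else g x)"
    have "(\<Sum>x\<in>C. u x *s x) = (\<Sum>x\<in>C - B. u x *s x) + (\<Sum>x\<in>B. u x *s x)"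
      by (rule sum.subset_diff[OF C(1) finC])
    also have "(\<Sum>x\<in>C - B. u x *s x) = (\<Sum>x\<in>C - B. g x *s x)"
      by (intro sum.cong) (auto simp: u_def)
    also have "(\<Sum>x\<in>B. u x *s x) = (\<Sum>x\<in>B. - (h x *s x))"
      by (intro sum.cong) (auto simp: u_def)
    also have "(\<Sum>x\<in>C - B. g x *s x) + \<dots> = 0"
      using sum_g h by (simp add: sum_negf)
    finally have zero: "(\<Sum>x\<in>C. u x *s x) = 0" .
    have "b i \<in> C - B" using b i by (auto simp: bij_betw_def)
    then have "u (b i) = 0"
      using vec.independentD[OF C(2) finC subset_refl zero] by auto
    then show "c i = 0" using \<open>b i \<in> C - B\<close> g[OF i] by (simp add: u_def)
  qed (rule S)
  then show ?thesis by blast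
qed

text \<open>The spaces \<open>W\<close> cover the q^k (q^l - 1) vectors outside \<open>L\<close>,
  and each contains q^k (q - 1) of them. Multiplying by q - 1 avoids a division.\<close>

lemma card_superspaces:
  fixes L :: "('a::{field,finite} ^ 'n::finite) set"
  assumes L: "vec.subspace L" "vec.dim L = k" and n: "CARD('n) = k + l"
  shows "CARD('a) ^ l - 1 \<le> (CARD('a) - 1) * card {W. vec.subspace W \<and> vec.dim W = Suc k \<and> L \<subseteq> W}"
proof -
  let ?q = "CARD('a)" and ?W = "{W. vec.subspace W \<and> vec.dim W = Suc k \<and> L \<subseteq> W}"
  have "x \<in> \<Union>((\<lambda>W. W - L) ` ?W)" if "x \<notin> L" for x
  proof -
    have "x \<notin> vec.span L" using that L(1) by (simp add: vec.span_eq_iff[THEN iffD2])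
    then have "vec.dim (vec.span (insert x L)) = Suc k"
      using L(2) by (simp add: vec.dim_insert)
    moreover have "insert x L \<subseteq> vec.span (insert x L)" by (rule vec.span_superset)
    ultimately show ?thesis
      using that vec.subspace_span by (intro UN_I[of "vec.span (insert x L)"]) auto
  qed
  then have "card (UNIV - L) \<le> card (\<Union>((\<lambda>W. W - L) ` ?W))"
    by (intro card_mono) auto
  also have "\<dots> \<le> (\<Sum>W\<in>?W. card (W - L))" by (rule card_UN_le) simp
  also have "\<dots> = (\<Sum>W\<in>?W. ?q ^ k * (?q - 1))"
  proof (rule sum.cong)
    fix W assume W: "W \<in> ?W"
    then have "card W = ?q ^ k * ?q" using card_subspace[of W] by simp
    moreover have "card (W - L) = card W - card L" using W by (intro card_Diff_subset) auto
    ultimately show "card (W - L) = ?q ^ k * (?q - 1)"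
      using card_subspace[OF L(1)] L(2) by (simp add: diff_mult_distrib2)
  qed simp
  finally have "card (UNIV - L) \<le> ?q ^ k * ((?q - 1) * card ?W)" by (simp add: algebra_simps)
  moreover have "card (UNIV - L) = ?q ^ k * (?q ^ l - 1)"
  proof -
    have "card (UNIV :: ('a ^ 'n) set) = ?q ^ k * ?q ^ l"
      using card_subspace[OF vec.subspace_UNIV, where 'a = 'a and 'n = 'n] n
      by (simp add: card_cart_basis power_add)
    moreover have "card (UNIV - L) = card (UNIV :: ('a ^ 'n) set) - card L"
      by (intro card_Diff_subset) auto
    ultimately show ?thesis using card_subspace[OF L(1)] L(2) by (simp add: diff_mult_distrib2)
  qed
  ultimately show ?thesis by simp
qed

text \<open>A fixed nonzero space \<^term>\<open>L\<close> is contained in exactly one member of each code that is counted,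
  so that these codes are distinct.\<close>
lemma codes_lower_bound:
  assumes n: "CARD('n::finite) = m + r" and r: "2 \<le> r" "r \<le> m"
    and H: "\<And>S :: ('a::{field,finite} ^ 'n) set. vec.subspace S \<Longrightarrow> vec.dim S = m \<Longrightarrow>
      H \<le> card {Z \<in> codes r. \<forall>V\<in>Z. V \<inter> S = {0}}"
  shows "(CARD('a) ^ (m + 1) - 1) * H \<le> (CARD('a) - 1) * card (codes r :: ('a ^ 'n) set set set)"
proof -
  obtain L :: "('a ^ 'n) set" where L: "vec.subspace L" "vec.dim L = r - 1"
  proof -
    have "\<exists>L :: ('a ^ 'n) set. vec.subspace L \<and> vec.dim L = r - 1 \<and> {0} \<subseteq> L"
      using n by (intro ex_subspace_between) auto
    then show ?thesis using that by blast
  qed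
  define Ws where "Ws = {W. vec.subspace W \<and> vec.dim W = Suc (r - 1) \<and> L \<subseteq> W}"
  have card_Ws: "CARD('a) ^ (m + 1) - 1 \<le> (CARD('a) - 1) * card Ws"
    unfolding Ws_def using card_superspaces[OF L, of "m + 1"] n r by simp
  \<comment> \<open>An \<open>r\<close>-dimensional \<open>W\<close> fits into an
    \<open>m\<close>-dimensional \<open>S\<close> because \<open>r \<le> m\<close>.\<close>
  have "\<forall>W\<in>Ws. \<exists>S. vec.subspace S \<and> vec.dim S = m \<and> W \<subseteq> S"
    using n r by (intro ballI ex_subspace_between) (auto simp: Ws_def)
  then obtain S where S: "\<And>W. W \<in> Ws \<Longrightarrow> vec.subspace (S W) \<and> vec.dim (S W) = m \<and> W \<subseteq> S W"
    by (auto simp: bchoice_iff)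
  define Z where "Z = (\<lambda>W. {Z \<in> codes r. \<forall>V\<in>Z. V \<inter> S W = {0}})"
  \<comment> \<open>Both \<open>W'\<close> and \<open>S W\<close> contain \<open>L\<close>, which is
    nonzero because \<open>r \<ge> 2\<close>, so a member of \<open>Ws\<close> never avoids
    \<open>S W\<close>.\<close>
  have W_notin: "W' \<notin> Y" if W: "W \<in> Ws" "W' \<in> Ws" and Y: "Y \<in> Z W" for W W' Y
  proof
    assume "W' \<in> Y"
    then have "W' \<inter> S W = {0}" using Y by (auto simp: Z_def)
    then have "L \<subseteq> {0}" using W S[OF W(1)] by (auto simp: Ws_def)
    then show False using L(2) r vec.dim_eq_0[of L] by simp
  qed
  have "card Ws * H \<le> (\<Sum>W\<in>Ws. card (insert W ` Z W))"
  proof -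
    have "H \<le> card (insert W ` Z W)" if W: "W \<in> Ws" for W
    proof -
      have "inj_on (insert W) (Z W)"
        using W_notin[OF W W] by (intro inj_on_inverseI[where g = "\<lambda>Y. Y - {W}"]) auto
      then show ?thesis
        using H[of "S W"] S[OF W] by (simp add: card_image Z_def)
    qed
    then show ?thesis using sum_mono[of Ws "\<lambda>_. H" "\<lambda>W. card (insert W ` Z W)"] by simp
  qed
  also have "\<dots> = card (\<Union>W\<in>Ws. insert W ` Z W)"
  proof (rule card_UN_disjoint[symmetric])
    show "\<forall>W\<in>Ws. \<forall>W'\<in>Ws. W \<noteq> W' \<longrightarrow> insert W ` Z W \<inter> insert W' ` Z W' = {}"
    proof (intro ballI impI, rule ccontr)
      fix W W' assume W: "W \<in> Ws" "W' \<in> Ws" "W \<noteq> W'" "insert W ` Z W \<inter> insert W' ` Z W' \<noteq> {}"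
      from W(4) obtain Y Y' where Y: "Y \<in> Z W" "insert W Y = insert W' Y'" by auto
      then have "W' \<in> Y" using W(3) by auto
      then show False using W_notin[OF W(1,2) Y(1)] by simp
    qed
  qed auto
  also have "\<dots> \<le> card (codes r :: ('a ^ 'n) set set set)"
  proof (rule card_mono)
    show "(\<Union>W\<in>Ws. insert W ` Z W) \<subseteq> codes r"
    proof clarify
      fix W Y assume W: "W \<in> Ws" and Y: "Y \<in> Z W"
      have YC: "Y \<in> codes r" using Y by (simp add: Z_def)
      have small: "vec.dim (V \<inter> W) = 0" if "V \<in> Y" for V
      proof -
        have "V \<inter> W \<subseteq> {0}" using Y that S[OF W] by (auto simp: Z_def)
        then show ?thesis using vec.dim_eq_0[of "V \<inter> W"] by simp
      qed
      show "insert W Y \<in> codes r"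
      proof (rule codesI)
        fix U V assume "U \<in> insert W Y" "V \<in> insert W Y" "U \<noteq> V"
        then consider "U \<in> Y" "V \<in> Y" | "U \<in> Y" "V = W" | "U = W" "V \<in> Y" by auto
        then show "vec.dim (U \<inter> V) + 2 \<le> r"
        proof cases
          case 1 then show ?thesis using codesD(3)[OF YC] \<open>U \<noteq> V\<close> by simp
        next
          case 2 then show ?thesis using small[of U] r by (simp del: vec.dim_eq_0)
        next
          case 3 then show ?thesis using small[of V] r by (simp add: Int_commute[of W] del: vec.dim_eq_0)
        qed
      qed (use W r codesD[OF YC] in \<open>auto simp: Ws_def\<close>)
    qed
  qed simp
  finally have "card Ws * H \<le> card (codes r :: ('a ^ 'n) set set set)" .
  then have "(CARD('a) - 1) * card Ws * H \<le> (CARD('a) - 1) * card (codes r :: ('a ^ 'n) set set set)"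
    by (simp add: mult.assoc)
  then show ?thesis
    using mult_le_mono1[OF card_Ws, of H] by linarith
qed

subsection \<open>Finite extensions of finite fields\<close>

text \<open>Multiplication by a nonzero \<open>x\<close> permutes the nonzero elements and so
  preserves their product.\<close>

lemma finite_field_power_card:
  fixes x :: "'a::{field,finite}"
  shows "x ^ CARD('a) = x"
proof (cases "x = 0")
  case False
  have "(\<Prod>y\<in>UNIV - {0}. x * y) = \<Prod>(UNIV - {0})"
    by (rule prod.reindex_bij_witness[of _ "\<lambda>y. y / x" "\<lambda>y. x * y"]) (use False in auto)
  then have "x ^ card (UNIV - {0 :: 'a}) * \<Prod>(UNIV - {0}) = 1 * \<Prod>(UNIV - {0})"
    by (simp only: prod.distrib prod_constant mult_1_left)
  moreover have "\<Prod>(UNIV - {0 :: 'a}) \<noteq> 0" by simp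
  ultimately have "x ^ card (UNIV - {0 :: 'a}) = 1" by (simp only: mult_cancel_right) simp
  moreover have "CARD('a) = Suc (card (UNIV - {0 :: 'a}))"
    by (rule card.remove) auto
  ultimately show ?thesis by (simp only: power_Suc mult_1_right)
qed simp

text \<open>Translation by 1 permutes the field, so adding 1 to every element leaves the sum of all
  elements unchanged.\<close>

lemma of_nat_card_finite_field: "of_nat (CARD('a)) = (0 :: 'a::{field,finite})"
proof -
  have "(\<Sum>y\<in>UNIV. y + 1) = \<Sum>(UNIV :: 'a set)"
    by (rule sum.reindex_bij_witness[of _ "\<lambda>y. y - 1" "\<lambda>y. y + 1"]) auto
  then show ?thesis by (simp add: sum.distrib)
qed

text \<open>The polynomial $x^q - x$ is the product of all $x - a$ for $a$ in the finite field, hence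
  invariant under translations by $a$.\<close>
lemma alg_closure_power_card_add:
  fixes x y :: "'a::{field,finite} alg_closure"
  shows "(x + y) ^ CARD('a) = x ^ CARD('a) + y ^ CARD('a)"
proof -
  let ?q = "CARD('a)" and ?F = "range (to_ac :: 'a \<Rightarrow> 'a alg_closure)"
  have q: "2 \<le> ?q" by (rule two_le_card_field)
  have card_F: "card ?F = ?q" by (simp add: card_image[OF inj_to_ac])
  have power_F: "to_ac c ^ ?q = to_ac c" for c :: 'a
    by (simp add: finite_field_power_card flip: to_ac_power)
  define f where "f = (\<Prod>a\<in>UNIV. [:- to_ac a, 1:] :: 'a alg_closure poly)"
  have deg_f: "Polynomial.degree f = ?q" by (simp add: f_def degree_prod_sum_eq)
  \<comment> \<open>Polynomials of degree at most q with equal coefficients at q that agree on the q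
    points of \<open>?F\<close> are equal.\<close>
  have f_eq: "f = Polynomial.monom 1 ?q - Polynomial.monom 1 1"
  proof (rule poly_eqI_degree_lead_coeff)
    have "Polynomial.lead_coeff f = 1" by (simp add: f_def lead_coeff_prod)
    then show "poly.coeff f ?q = poly.coeff (Polynomial.monom 1 ?q - Polynomial.monom 1 1) ?q"
      using q by (simp add: deg_f)
    show "Polynomial.degree (Polynomial.monom 1 ?q - Polynomial.monom (1 :: 'a alg_closure) 1) \<le> ?q"
      using q by (intro degree_diff_le) (auto simp: degree_monom_eq)
    show "poly f z = poly (Polynomial.monom 1 ?q - Polynomial.monom 1 1) z" if "z \<in> ?F" for z
      using that by (auto simp: f_def poly_prod poly_monom power_F)
  qed (use card_F deg_f in simp_all)
  have f: "(\<Prod>a\<in>UNIV. z - to_ac a) = z ^ ?q - z" for z :: "'a alg_closure"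
  proof -
    have "(\<Prod>a\<in>UNIV. z - to_ac a) = poly f z" by (simp add: f_def poly_prod)
    also have "\<dots> = z ^ ?q - z" unfolding f_eq by (simp add: poly_monom)
    finally show ?thesis .
  qed
  have shift: "(to_ac c + y) ^ ?q = to_ac c + y ^ ?q" for c
  proof -
    have "(\<Prod>a\<in>UNIV. (to_ac c + y) - to_ac a) = (\<Prod>a\<in>UNIV. y - to_ac a)"
      by (rule prod.reindex_bij_witness[of _ "\<lambda>a. a + c" "\<lambda>a. a - c"]) auto
    then show ?thesis by (simp add: f algebra_simps)
  qed
  \<comment> \<open>For fixed \<open>y\<close>, \<open>shift\<close> is additivity on the embedded
    field only. Both sides are monic of degree q, so the same interpolation argument makes them
    equal as polynomials, and they can then be evaluated at any \<open>x\<close>.\<close>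
  have lin_eq: "[:y, 1:] ^ ?q = Polynomial.monom 1 ?q + [:y ^ ?q:]"
  proof (rule poly_eqI_degree_lead_coeff)
    have deg: "Polynomial.degree ([:y, 1:] ^ ?q) = ?q" by (simp add: degree_power_eq)
    moreover have "Polynomial.lead_coeff ([:y, 1:] ^ ?q) = 1" by (simp add: lead_coeff_power)
    ultimately show "poly.coeff ([:y, 1:] ^ ?q) ?q = poly.coeff (Polynomial.monom 1 ?q + [:y ^ ?q:]) ?q"
      using q by (simp add: coeff_pCons split: nat.split)
    show "Polynomial.degree ([:y, 1:] ^ ?q) \<le> ?q" using deg by simp
    show "Polynomial.degree (Polynomial.monom 1 ?q + [:y ^ ?q:]) \<le> ?q"
      by (intro degree_add_le) (auto simp: degree_monom_eq)
    show "poly ([:y, 1:] ^ ?q) z = poly (Polynomial.monom 1 ?q + [:y ^ ?q:]) z" if "z \<in> ?F" for z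
      using that shift by (auto simp: poly_monom power_F add.commute)
  qed (use card_F in simp)
  have "(x + y) ^ ?q = poly ([:y, 1:] ^ ?q) x" by (simp add: add.commute)
  also have "\<dots> = x ^ ?q + y ^ ?q" unfolding lin_eq by (simp add: poly_monom)
  finally show ?thesis .
qed

lemma alg_closure_power_card_power_add:
  fixes x y :: "'a::{field,finite} alg_closure"
  shows "(x + y) ^ (CARD('a) ^ m) = x ^ (CARD('a) ^ m) + y ^ (CARD('a) ^ m)"
  by (induction m) (simp_all add: power_mult mult.commute[of "CARD('a)"] alg_closure_power_card_add)

text \<open>The derivative of x^Q - x is -1, so no linear factor over the algebraic closure is
  repeated and there are Q distinct roots.\<close>

lemma card_roots_power_card:
  assumes "0 < m"
  shows "card {x :: 'a::{field,finite} alg_closure. x ^ (CARD('a) ^ m) = x} = CARD('a) ^ m"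
proof -
  let ?Q = "CARD('a) ^ m"
  have Q: "2 \<le> ?Q"
    using two_le_card_field[where 'a = 'a] self_le_power[of "CARD('a)" m] assms by linarith
  define P where "P = Polynomial.monom 1 ?Q - Polynomial.monom (1 :: 'a alg_closure) 1"
  have "of_nat ?Q = (0 :: 'a alg_closure)"
  proof -
    have "of_nat (CARD('a)) = to_ac (of_nat (CARD('a)) :: 'a)" by simp
    then show ?thesis using assms by (simp only: of_nat_card_finite_field) simp
  qed
  then have dP: "pderiv P = [:- 1:]"
    using assms by (simp add: P_def pderiv_diff pderiv_monom monom_0 power_0_left)
  have P1: "poly.coeff P ?Q = 1" using Q by (simp add: P_def)
  have degP: "Polynomial.degree P = ?Q"
  proof (rule antisym)
    show "Polynomial.degree P \<le> ?Q"
      unfolding P_def using Q by (intro degree_diff_le) (auto simp: degree_monom_eq)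
    show "?Q \<le> Polynomial.degree P" using P1 by (intro le_degree) simp
  qed
  then have "P \<noteq> 0" using Q by auto
  then obtain A where A: "size A = Polynomial.degree P" "P = Polynomial.smult (Polynomial.lead_coeff P) (\<Prod>x\<in>#A. [:- x, 1:])"
    using alg_closed_imp_factorization by blast
  have PA: "P = (\<Prod>x\<in>#A. [:- x, 1:])" using A(2) P1 degP by simp
  have simple: "count A x \<le> 1" for x
  proof (rule ccontr)
    assume "\<not> count A x \<le> 1"
    then have x: "x \<in># A" "x \<in># A - {#x#}"
      by (auto simp: in_diff_count simp flip: count_greater_zero_iff)
    obtain C where C: "A = add_mset x C" using x(1) by (meson multi_member_split)
    then obtain D where D: "C = add_mset x D" using x(2) by (auto dest: multi_member_split)
    define R where "R = (\<Prod>y\<in>#D. [:- y, 1:])"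
    have "P = [:- x, 1:] * ([:- x, 1:] * R)"
      unfolding PA C D R_def by (simp only: image_mset_add_mset prod_mset.add_mset)
    then have "poly (pderiv P) x = 0" by (simp only: pderiv_mult poly_add poly_mult) simp
    then show False by (simp add: dP)
  qed
  have "count A x = count (mset_set (set_mset A)) x" for x
  proof (cases "x \<in># A")
    case True
    then have "0 < count A x" by simp
    then have "count A x = 1" using simple[of x] by linarith
    then show ?thesis using True by simp
  next
    case False
    then have "count A x = 0" by (simp only: not_in_iff)
    then show ?thesis using False by simp
  qed
  then have "A = mset_set (set_mset A)" by (rule multiset_eqI)
  then have "size A = size (mset_set (set_mset A))" by (rule arg_cong)
  then have "card (set_mset A) = ?Q" by (simp only: size_mset_set A(1) degP)
  moreover have "set_mset A = {x. x ^ ?Q = x}"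
  proof -
    have "poly P x = 0 \<longleftrightarrow> x \<in># A" for x
    proof -
      have "poly P x = (\<Prod>y\<in>#A. poly [:- y, 1:] x)" unfolding PA by (rule poly_prod_mset)
      then have "poly P x = 0 \<longleftrightarrow> (\<exists>y\<in>set_mset A. 0 = poly [:- y, 1:] x)"
        by (simp only: prod_mset_zero_iff set_image_mset image_iff)
      also have "\<dots> \<longleftrightarrow> (\<exists>y\<in>set_mset A. x = y)"
        by (intro bex_cong) auto
      also have "\<dots> \<longleftrightarrow> x \<in># A" by simp
      finally show ?thesis .
    qed
    then show ?thesis by (auto simp: P_def poly_monom)
  qed
  ultimately show ?thesis by simp
qed

interpretation ac: vector_space "\<lambda>(c :: 'a::field) (x :: 'a alg_closure). to_ac c * x"
  by unfold_locales (simp_all add: algebra_simps)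

text \<open>The roots of x^(q^m) - x are closed under addition because x \<mapsto> x^(q^m) is
  additive. Freedom from zero divisors is inherited from the surrounding closure.\<close>

lemma ex_finite_extension:
  assumes "0 < m"
  shows "\<exists>E :: 'a::{field,finite} alg_closure set. ac.subspace E \<and> card E = CARD('a) ^ m \<and> 1 \<in> E \<and>
    (\<forall>x\<in>E. \<forall>y\<in>E. x * y \<in> E)"
proof (intro exI conjI)
  let ?E = "{x :: 'a alg_closure. x ^ (CARD('a) ^ m) = x}"
  have "c ^ (CARD('a) ^ m) = c" for c :: 'a
    by (induction m) (simp_all add: power_mult finite_field_power_card)
  then have "to_ac c ^ (CARD('a) ^ m) = to_ac c" for c :: 'a
    by (simp flip: to_ac_power)
  then show "ac.subspace ?E"
    by (auto simp: ac.subspace_def alg_closure_power_card_power_add power_mult_distrib)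
qed (use card_roots_power_card[OF assms] in \<open>auto simp: power_mult_distrib\<close>)

subsection \<open>Operator systems from field multiplication\<close>

lemma (in vector_space) independent_family_zero:
  assumes "independent T" "inj_on h K" "h ` K \<subseteq> T" "finite K"
    and "(\<Sum>k\<in>K. scale (c k) (h k)) = 0" "k \<in> K"
  shows "c k = 0"
proof -
  define u where "u = (\<lambda>x. c (inv_into K h x))"
  have u: "u (h k) = c k" if "k \<in> K" for k using that assms(2) by (simp add: u_def)
  have "(\<Sum>x\<in>h ` K. scale (u x) x) = (\<Sum>k\<in>K. scale (u (h k)) (h k))"
    by (simp add: sum.reindex[OF assms(2)])
  also have "\<dots> = 0" using assms(5) u by (simp cong: sum.cong)
  finally have "u (h k) = 0"
    using independentD[OF assms(1) _ assms(3)] assms(4,6) by blast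
  then show ?thesis using u assms(6) by simp
qed

lemma ex_bij_betw_extend:
  assumes "finite A" "finite B" "card A = card B" "A' \<subseteq> A" "inj_on f A'" "f ` A' \<subseteq> B"
  shows "\<exists>g. bij_betw g A B \<and> (\<forall>x\<in>A'. g x = f x)"
proof -
  have fin: "finite A'" using assms(1,4) by (rule finite_subset[rotated])
  have "card (A - A') = card (B - f ` A')"
    using assms fin by (simp add: card_Diff_subset card_image)
  then obtain h where h: "bij_betw h (A - A') (B - f ` A')"
    using finite_same_card_bij[of "A - A'" "B - f ` A'"] assms(1,2) by auto
  define g where "g = (\<lambda>x. if x \<in> A' then f x else h x)"
  have "bij_betw g A' (f ` A')"
    using assms(5) by (auto simp: bij_betw_def g_def inj_on_def)
  moreover have "bij_betw g (A - A') (B - f ` A')"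
    using h by (rule bij_betw_cong[THEN iffD1, rotated]) (simp add: g_def)
  ultimately have "bij_betw g (A' \<union> (A - A')) (f ` A' \<union> (B - f ` A'))"
    by (rule bij_betw_combine) auto
  moreover have "A' \<union> (A - A') = A" "f ` A' \<union> (B - f ` A') = B" using assms(4,6) by auto
  ultimately show ?thesis by (auto simp: g_def)
qed

lemma quadratic_roots:
  fixes a b :: "'a::field"
  shows "finite {x. x\<^sup>2 = a * x + b}" and "card {x. x\<^sup>2 = a * x + b} \<le> 2"
proof -
  \<comment> \<open>If a root exists, \<open>y\<close> is one and \<open>a - y\<close> is the other;
    if none exists, \<open>y\<close> is arbitrary and the inclusion is trivial.\<close>
  define y where "y = (SOME y. y\<^sup>2 = a * y + b)"
  have sub: "{x. x\<^sup>2 = a * x + b} \<subseteq> {y, a - y}"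
  proof
    fix x assume "x \<in> {x. x\<^sup>2 = a * x + b}"
    then have x: "x\<^sup>2 = a * x + b" by simp
    then have y: "y\<^sup>2 = a * y + b" unfolding y_def by (rule someI)
    have "(x - y) * (x - (a - y)) = (x\<^sup>2 - a * x) - (y\<^sup>2 - a * y)"
      by (simp add: power2_eq_square algebra_simps)
    also have "\<dots> = 0" by (simp add: x y)
    finally have "x = y \<or> x = a - y" by (simp only: mult_eq_0_iff right_minus_eq)
    then show "x \<in> {y, a - y}" by simp
  qed
  from sub show "finite {x. x\<^sup>2 = a * x + b}" by (rule finite_subset) simp
  have "card {x. x\<^sup>2 = a * x + b} \<le> card {y, a - y}" by (rule card_mono[OF _ sub]) simp
  also have "\<dots> \<le> 2" by (simp add: card_insert_if)
  finally show "card {x. x\<^sup>2 = a * x + b} \<le> 2" .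
qed

text \<open>If 1, x, x^2 are dependent, x lies in the base field or is a root of a monic quadratic
  over it, and these x are too few to fill \<open>E\<close>. The disequalities are recorded because
  independence of a set does not exclude that its listed elements coincide.\<close>

lemma ex_independent_powers:
  fixes E :: "'a::{field,finite} alg_closure set"
  assumes "finite E" "CARD('a) ^ 3 \<le> card E"
  shows "\<exists>x\<in>E. ac.independent {1, x, x\<^sup>2} \<and> x \<noteq> 1 \<and> x\<^sup>2 \<noteq> 1 \<and> x\<^sup>2 \<noteq> x"
proof -
  let ?q = "CARD('a)"
  define R where "R = (\<lambda>(a, b). {x :: 'a alg_closure. x\<^sup>2 = to_ac a * x + to_ac b})"
  \<comment> \<open>A quadratic with constant term 0 has its roots in the base field, which is
    counted already. Omitting these gives q + 2q(q - 1) < q^3; with them the estimate would fail for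
    q = 2.\<close>
  let ?U = "UNIV \<times> (UNIV - {0 :: 'a}) :: ('a \<times> 'a) set"
  let ?bad = "range (to_ac :: 'a \<Rightarrow> _) \<union> (\<Union>p\<in>?U. R p)"
  have q: "2 \<le> ?q" by (rule two_le_card_field)
  have "card (\<Union>p\<in>?U. R p) \<le> (\<Sum>p\<in>?U. card (R p))" by (rule card_UN_le) simp
  also have "\<dots> \<le> (\<Sum>p\<in>?U. 2)"
    by (rule sum_mono) (auto simp: R_def quadratic_roots)
  also have "\<dots> = 2 * (?q * (?q - 1))" by (simp add: card_cartesian_product card_Diff_subset)
  finally have card_R: "card (\<Union>p\<in>?U. R p) \<le> 2 * (?q * (?q - 1))" .
  have "card (range (to_ac :: 'a \<Rightarrow> 'a alg_closure)) = ?q" by (simp add: card_image[OF inj_to_ac])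
  then have "card ?bad \<le> ?q + 2 * (?q * (?q - 1))"
    using card_Un_le[of "range (to_ac :: 'a \<Rightarrow> _)" "\<Union>p\<in>?U. R p"] card_R by linarith
  also have "\<dots> < ?q ^ 3"
  proof -
    obtain k where k: "?q = k + 2" using q by (metis add.commute le_Suc_ex)
    show ?thesis unfolding k by (simp add: power3_eq_cube algebra_simps)
  qed
  finally have "card ?bad < card E" using assms(2) by simp
  then have "\<not> E \<subseteq> ?bad"
    using card_mono[of ?bad E] by (auto simp: R_def quadratic_roots)
  then obtain x where x: "x \<in> E" "x \<notin> ?bad" by blast
  then have x_F: "x \<notin> range to_ac" by blast
  have x_quad: "x\<^sup>2 \<noteq> to_ac a * x + to_ac b" if "b \<noteq> 0" for a b
    using x(2) that by (auto simp: R_def)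
  have span1: "ac.span {1 :: 'a alg_closure} = range to_ac" by (simp add: ac.span_singleton)
  have x1: "x \<notin> ac.span {1}" using x_F span1 by simp
  have x2: "x\<^sup>2 \<notin> ac.span {x, 1}"
  proof
    assume "x\<^sup>2 \<in> ac.span {x, 1}"
    then obtain a b where ab: "x\<^sup>2 - to_ac a * x = to_ac b"
      unfolding ac.span_breakdown_eq[of _ x "{1}"] span1 by auto
    then have *: "x\<^sup>2 = to_ac a * x + to_ac b" by (simp add: algebra_simps)
    show False
    proof (cases "b = 0")
      case True
      then have "x * (x - to_ac a) = 0" using * by (simp add: power2_eq_square algebra_simps)
      then have "x = to_ac 0 \<or> x = to_ac a" by auto
      then show False using x_F by blast
    qed (use x_quad * in blast)
  qed
  have "ac.independent {x\<^sup>2, x, 1}"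
    using x1 x2 by (intro ac.independent_insertI ac.independent_empty) auto
  moreover have "x \<noteq> 1" using x_F by (metis rangeI to_ac_1)
  moreover have "x\<^sup>2 \<noteq> 1" "x\<^sup>2 \<noteq> x" using x2 ac.span_base[of _ "{x, 1}"] by auto
  ultimately show ?thesis using x(1) by (auto simp: insert_commute)
qed

interpretation acv: vector_space_pair "\<lambda>(c :: 'a::field) (x :: 'a alg_closure). to_ac c * x"
  "(*s) :: 'a \<Rightarrow> 'a ^ 'n::finite \<Rightarrow> 'a ^ 'n" ..

text \<open>The prescribed values are completed to a basis \<open>C\<close> of \<open>S\<close>, and
  the rest of \<open>T\<close> is matched with the rest of \<open>C\<close>. The linear extension
  maps \<open>E\<close> onto \<open>S\<close>, and equal finite cardinality makes it
  bijective.\<close>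

lemma ex_linear_iso_extending:
  fixes E :: "'a::{field,finite} alg_closure set" and S :: "('a ^ 'n::finite) set"
  assumes T: "ac.independent T" "ac.span T = E" "card T = vec.dim S" "finite T"
    and S: "vec.subspace S"
    and T': "T' \<subseteq> T" "inj_on f T'" "f ` T' \<subseteq> S" "vec.independent (f ` T')"
  shows "\<exists>\<phi>. Vector_Spaces.linear (\<lambda>c x. to_ac c * x) (*s) \<phi> \<and> (\<forall>x\<in>T'. \<phi> x = f x) \<and>
    bij_betw \<phi> E S"
proof -
  obtain C where C: "f ` T' \<subseteq> C" "C \<subseteq> S" "vec.independent C" "S \<subseteq> vec.span C"
    using vec.maximal_independent_subset_extend[OF T'(3,4)] by blast
  have SC: "vec.span C = S" using C S by (intro subset_antisym vec.span_minimal)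
  have cC: "card C = vec.dim S" using C by (intro vec.basis_card_eq_dim)
  have finC: "finite C" using C(3) by (rule vec.finiteI_independent)
  obtain g where g: "bij_betw g T C" "\<forall>x\<in>T'. g x = f x"
    using ex_bij_betw_extend[OF T(4) finC _ T'(1,2) C(1)] T(3) cC by auto
  obtain \<phi> where \<phi>: "Vector_Spaces.linear (\<lambda>c x. to_ac c * x) (*s) \<phi>" "\<forall>x\<in>T. \<phi> x = g x"
    using acv.linear_independent_extend[OF T(1)] by blast
  have "\<phi> ` T = C" using g(1) \<phi>(2) by (auto simp: bij_betw_def)
  then have img: "\<phi> ` E = S"
    using acv.linear_span_image[OF \<phi>(1), of T] T(2) SC by simp
  have "card E = card S"
    using ac.card_span_independent[OF _ T(4,1)] T(2,3) card_subspace[OF S] by simp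
  moreover have "finite E"
    using ac.card_span_independent[OF _ T(4,1)] T(2) by (intro card_ge_0_finite) auto
  ultimately have "bij_betw \<phi> E S"
    using img by (simp add: bij_betw_def eq_card_imp_inj_on)
  moreover have "\<forall>x\<in>T'. \<phi> x = f x" using \<phi>(2) g(2) T'(1) by auto
  ultimately show ?thesis using \<phi>(1) by blast
qed

text \<open>\<open>B i k\<close> is multiplication by the basis element \<open>h k\<close> of the
  field \<open>E\<close>, conjugated by an isomorphism \<phi> that sends 1, x, x^2 to e, s, s',
  where \<open>i = (s, s')\<close>. A nontrivial combination is multiplication by a nonzero field
  element, hence injective; \<open>r \<le> m\<close> provides enough basis elements. Since
  \<open>B i 1\<close> maps e to s and s to s', it determines \<open>i\<close>.\<close>

lemma ex_operator_system_field:
  fixes S :: "('a::{field,finite} ^ 'n::finite) set"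
  assumes S: "vec.subspace S" "vec.dim S = m" and n: "m + r = CARD('n)" and r: "3 \<le> m" "2 \<le> r" "r \<le> m"
  shows "\<exists>b (I :: (('a ^ 'n) \<times> ('a ^ 'n)) set) B. operator_system S b r I B \<and>
    card I = (CARD('a) ^ m - CARD('a)) * (CARD('a) ^ m - CARD('a) ^ 2)"
proof -
  let ?q = "CARD('a)"
  obtain b where b: "complementary_basis S b r"
    using ex_complementary_basis[OF S(1)] S(2) n by blast
  obtain E :: "'a alg_closure set" where E: "ac.subspace E" "card E = ?q ^ m" "1 \<in> E"
    and E_mult: "\<And>x y. x \<in> E \<Longrightarrow> y \<in> E \<Longrightarrow> x * y \<in> E"
    using ex_finite_extension[of m, where 'a = 'a] r(1) by auto
  have finE: "finite E" using E(2) by (intro card_ge_0_finite) simp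
  have "?q ^ 3 \<le> card E" unfolding E(2) using r(1) by (intro power_increasing) auto
  then obtain x where x: "x \<in> E" "ac.independent {1, x, x\<^sup>2}" "x \<noteq> 1" "x\<^sup>2 \<noteq> 1" "x\<^sup>2 \<noteq> x"
    using ex_independent_powers[OF finE] by blast
  have "{1, x, x\<^sup>2} \<subseteq> E" using x(1) E(3) E_mult[OF x(1) x(1)] by (simp add: power2_eq_square)
  then obtain T where T: "{1, x, x\<^sup>2} \<subseteq> T" "T \<subseteq> E" "ac.independent T" "E \<subseteq> ac.span T"
    using ac.maximal_independent_subset_extend[OF _ x(2)] by blast
  have ET: "ac.span T = E" using T E(1) by (intro subset_antisym ac.span_minimal)
  have finT: "finite T" using T(2) finE by (rule finite_subset)
  have cT: "card T = m"
    using ac.card_span_independent[OF _ finT T(3)] ET E(2) two_le_card_field[where 'a = 'a]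
    by (simp add: power_inject_exp)
  \<comment> \<open>Position 0 must hold 1 to make \<open>B i 0\<close> the identity, and position 1
    holds x, whose operator tells the systems apart.\<close>
  define t where "t = (\<lambda>k :: nat. if k = 0 then 1 else x)"
  have "\<exists>h. bij_betw h {..<m} T \<and> (\<forall>k\<in>{0, 1}. h k = t k)"
  proof (rule ex_bij_betw_extend)
    show "inj_on t {0, 1}" using x(3) by (auto simp: inj_on_def t_def)
  qed (use finT cT T(1) r(1) in \<open>auto simp: t_def\<close>)
  then obtain h where h: "bij_betw h {..<m} T" "h 0 = 1" "h 1 = x" by (auto simp: t_def)
  have h_E: "h k \<in> E" if "k < r" for k
    using that h(1) T(2) r(3) by (auto simp: bij_betw_def)
  obtain e where e: "e \<in> S" "e \<noteq> 0"
    using vec.dim_eq_0[of S] S(2) r(1) by auto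
  \<comment> \<open>The images of x and x^2, each chosen outside the span of the images already
    fixed.\<close>
  define I where "I = Sigma (S - vec.span {e}) (\<lambda>s. S - vec.span {s, e})"
  have "\<exists>\<phi>. Vector_Spaces.linear (\<lambda>c x. to_ac c * x) (*s) \<phi> \<and> \<phi> 1 = e \<and> \<phi> x = fst i \<and>
      \<phi> (x\<^sup>2) = snd i \<and> bij_betw \<phi> E S" if i: "i \<in> I" for i
  proof -
    obtain s s' where s: "i = (s, s')" "s \<in> S" "s \<notin> vec.span {e}" "s' \<in> S" "s' \<notin> vec.span {s, e}"
      using i by (auto simp: I_def)
    have ind: "vec.independent {s', s, e}"
      using s e(2) by (intro vec.independent_insertI vec.independent_empty) auto
    have neq: "s' \<noteq> s" "s' \<noteq> e" "s \<noteq> e"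
      using s vec.span_base[of _ "{s, e}"] vec.span_base[of _ "{e}"] by auto
    define f where "f = (\<lambda>y. if y = 1 then e else if y = x then s else s')"
    have img: "f ` {1, x, x\<^sup>2} = {s', s, e}" using x by (auto simp: f_def)
    have "\<exists>\<phi>. Vector_Spaces.linear (\<lambda>c x. to_ac c * x) (*s) \<phi> \<and> (\<forall>y\<in>{1, x, x\<^sup>2}. \<phi> y = f y) \<and>
        bij_betw \<phi> E S"
    proof (rule ex_linear_iso_extending[OF T(3) ET _ finT S(1) T(1)])
      show "inj_on f {1, x, x\<^sup>2}" using x neq by (auto simp: inj_on_def f_def)
      show "f ` {1, x, x\<^sup>2} \<subseteq> S" unfolding img using s e by simp
      show "vec.independent (f ` {1, x, x\<^sup>2})" unfolding img by (rule ind)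
    qed (use cT S(2) in simp)
    then show ?thesis using x s(1) by (auto simp: f_def)
  qed
  then have "\<exists>\<phi>. \<forall>i\<in>I. Vector_Spaces.linear (\<lambda>c x. to_ac c * x) (*s) (\<phi> i) \<and> \<phi> i 1 = e \<and>
      \<phi> i x = fst i \<and> \<phi> i (x\<^sup>2) = snd i \<and> bij_betw (\<phi> i) E S"
    by (intro bchoice) blast
  then obtain \<phi> where \<phi>: "\<And>i. i \<in> I \<Longrightarrow> Vector_Spaces.linear (\<lambda>c x. to_ac c * x) (*s) (\<phi> i)"
    "\<And>i. i \<in> I \<Longrightarrow> \<phi> i 1 = e" "\<And>i. i \<in> I \<Longrightarrow> \<phi> i x = fst i" "\<And>i. i \<in> I \<Longrightarrow> \<phi> i (x\<^sup>2) = snd i"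
    "\<And>i. i \<in> I \<Longrightarrow> bij_betw (\<phi> i) E S"
    by blast
  define \<psi> where "\<psi> = (\<lambda>i. inv_into E (\<phi> i))"
  have \<psi>_in: "\<psi> i y \<in> E" and \<phi>_\<psi>: "\<phi> i (\<psi> i y) = y" if "i \<in> I" "y \<in> S" for i y
    using \<phi>(5)[OF that(1)] that(2)
    by (auto simp: \<psi>_def bij_betw_def intro: inv_into_into f_inv_into_f)
  have \<psi>_\<phi>: "\<psi> i (\<phi> i z) = z" if "i \<in> I" "z \<in> E" for i z
    using \<phi>(5)[OF that(1)] that(2) by (simp add: \<psi>_def bij_betw_def)
  have \<phi>_in: "\<phi> i z \<in> S" if "i \<in> I" "z \<in> E" for i z
    using \<phi>(5)[OF that(1)] that(2) by (auto simp: bij_betw_def)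
  have \<phi>_add: "\<phi> i (y + z) = \<phi> i y + \<phi> i z" if "i \<in> I" for i y z
    using \<phi>(1)[OF that] by (rule acv.linear_add)
  have \<phi>_scale: "\<phi> i (to_ac c * z) = c *s \<phi> i z" if "i \<in> I" for i c z
    using \<phi>(1)[OF that] by (rule acv.linear_scale)
  have \<psi>_add: "\<psi> i (y + z) = \<psi> i y + \<psi> i z" if "i \<in> I" "y \<in> S" "z \<in> S" for i y z
  proof -
    have "\<psi> i (\<phi> i (\<psi> i y + \<psi> i z)) = \<psi> i y + \<psi> i z"
      using that \<psi>_in by (intro \<psi>_\<phi> ac.subspace_add[OF E(1)])
    then show ?thesis using that by (simp add: \<phi>_add \<phi>_\<psi>)
  qed
  have \<psi>_scale: "\<psi> i (c *s y) = to_ac c * \<psi> i y" if "i \<in> I" "y \<in> S" for i c y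
  proof -
    have "\<psi> i (\<phi> i (to_ac c * \<psi> i y)) = to_ac c * \<psi> i y"
      using that \<psi>_in by (intro \<psi>_\<phi> ac.subspace_scale[OF E(1)])
    then show ?thesis using that by (simp add: \<phi>_scale \<phi>_\<psi>)
  qed
  define B where "B = (\<lambda>i k y. \<phi> i (h k * \<psi> i y))"
  have "operator_system S b r I B"
  proof (intro operator_system.intro b operator_system_axioms.intro)
    show "vec.dim S \<noteq> 0" using S(2) r by simp
    show "finite I" by simp
    fix i assume i: "i \<in> I"
    show "B i 0 y = y" if "y \<in> S" for y
      using i that by (simp add: B_def h(2) \<phi>_\<psi>)
    show "B i k (y + z) = B i k y + B i k z" if "k < r" "y \<in> S" "z \<in> S" for k y z
      using i that by (simp add: B_def \<psi>_add distrib_left \<phi>_add)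
    show "B i k (a *s y) = a *s B i k y" if "k < r" "y \<in> S" for k a y
      using i that by (simp add: B_def \<psi>_scale mult.left_commute[of "h k"] \<phi>_scale)
    show "B i k y \<in> S" if "k < r" "y \<in> S" for k y
      using i that by (auto simp: B_def intro!: \<phi>_in E_mult h_E \<psi>_in)
    show "c k = 0" if y: "y \<in> S" "y \<noteq> 0" and zero: "(\<Sum>k<r. c k *s B i k y) = 0" and k: "k < r" for c k y
    proof -
      \<comment> \<open>Pulled back to \<open>E\<close>, the vanishing combination is the product of
        the sum of the \<open>c k\<close> times \<open>h k\<close> with a nonzero element, so that
        sum is zero.\<close>
      have "\<phi> i ((\<Sum>k<r. to_ac (c k) * h k) * \<psi> i y) = (\<Sum>k<r. \<phi> i (to_ac (c k) * (h k * \<psi> i y)))"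
        using acv.linear_sum[OF \<phi>(1)[OF i]] by (simp add: sum_distrib_right mult.assoc)
      also have "\<dots> = 0" using zero by (simp add: B_def \<phi>_scale[OF i])
      also have "0 = \<phi> i 0" using acv.linear_0[OF \<phi>(1)[OF i]] by simp
      finally have "\<psi> i (\<phi> i ((\<Sum>k<r. to_ac (c k) * h k) * \<psi> i y)) = \<psi> i (\<phi> i 0)" by simp
      moreover have "(\<Sum>k<r. to_ac (c k) * h k) * \<psi> i y \<in> E"
        using i y h_E \<psi>_in by (intro E_mult ac.subspace_sum[OF E(1)] ac.subspace_scale[OF E(1)]) auto
      ultimately have "(\<Sum>k<r. to_ac (c k) * h k) * \<psi> i y = 0"
        using \<psi>_\<phi>[OF i] ac.subspace_0[OF E(1)] by simp
      moreover have "\<psi> i y \<noteq> 0"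
        using \<phi>_\<psi>[OF i y(1)] y(2) acv.linear_0[OF \<phi>(1)[OF i]] by auto
      ultimately have sum_0: "(\<Sum>k<r. to_ac (c k) * h k) = 0" by simp
      have "inj_on h {..<r}" "h ` {..<r} \<subseteq> T"
        using h(1) r(3) by (auto simp: bij_betw_def intro: inj_on_subset)
      then show ?thesis
        using k by (intro ac.independent_family_zero[OF T(3) _ _ finite_lessThan sum_0]) auto
    qed
    show "\<exists>y\<in>S. B i 1 y \<noteq> B j 1 y" if j: "j \<in> I" "i \<noteq> j" for j
    proof (rule ccontr)
      assume "\<not> ?thesis"
      then have eq: "B i 1 y = B j 1 y" if "y \<in> S" for y using that by blast
      have B_e: "B k 1 e = fst k" if "k \<in> I" for k
        using \<psi>_\<phi>[OF that E(3)] \<phi>(2,3)[OF that] by (simp add: B_def h(3)[unfolded One_nat_def])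
      have B_s: "B k 1 (fst k) = snd k" if "k \<in> I" for k
        using \<psi>_\<phi>[OF that x(1)] \<phi>(3,4)[OF that]
        by (simp add: B_def h(3)[unfolded One_nat_def] power2_eq_square)
      have 1: "fst i = fst j" using eq[OF e(1)] B_e i j(1) by simp
      have "fst i \<in> S" using i by (auto simp: I_def)
      then have "snd i = snd j" using eq B_s[OF i] B_s[OF j(1)] 1 by simp
      with 1 show False using j(2) by (simp add: prod_eq_iff)
    qed
  qed (use r in auto)
  moreover have "card I = (?q ^ m - ?q) * (?q ^ m - ?q ^ 2)"
  proof -
    have cS: "card S = ?q ^ m" using card_subspace[OF S(1)] S(2) by simp
    have "card (S - vec.span {s, e}) = ?q ^ m - ?q ^ 2" if s: "s \<in> S - vec.span {e}" for s
    proof -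
      have "vec.independent {s, e}" using s e by (intro vec.independent_insertI vec.independent_empty) auto
      moreover have "s \<noteq> e" using s vec.span_base[of e "{e}"] by auto
      ultimately have "card (vec.span {s, e}) = ?q ^ 2"
        using vec.card_span_independent[of "{s, e}"] by (simp add: power2_eq_square)
      moreover have "vec.span {s, e} \<subseteq> S" using s e S(1) by (intro vec.span_minimal) auto
      ultimately show ?thesis using cS by (simp add: card_Diff_subset)
    qed
    moreover have "card (S - vec.span {e}) = ?q ^ m - ?q"
    proof -
      have "card (vec.span {e}) = ?q" using vec.card_span_independent[of "{e}"] e by simp
      moreover have "vec.span {e} \<subseteq> S" using e S(1) by (intro vec.span_minimal) auto
      ultimately show ?thesis using cS by (simp add: card_Diff_subset)
    qed
    ultimately show ?thesis by (simp add: I_def card_SigmaI)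
  qed
  ultimately show ?thesis by blast
qed

subsection \<open>Planes over fields with at least three elements\<close>

text \<open>The map $x \mapsto x^2 - a x$ identifies $x$ with $a - x$. If it is not injective, it misses a value.\<close>
lemma ex_rootless_quadratics:
  assumes "3 \<le> CARD('a::{field,finite})"
  shows "\<exists>(A :: 'a set) \<beta>. 3 \<le> card A \<and> (\<forall>a\<in>A. \<forall>x. x\<^sup>2 \<noteq> a * x + \<beta> a)"
proof -
  define A where "A = {a :: 'a. \<exists>x. x + x \<noteq> a}"
  have rootless: "\<exists>b. \<forall>x. x\<^sup>2 \<noteq> a * x + b" if "a \<in> A" for a
  proof -
    from that have "\<exists>y. y + y \<noteq> a" by (simp only: A_def mem_Collect_eq)
    then obtain y where y: "y + y \<noteq> a" by blast
    let ?f = "\<lambda>x. x\<^sup>2 - a * x"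
    have "?f y = ?f (a - y)" by (simp add: power2_eq_square algebra_simps)
    moreover have "y \<noteq> a - y" using y by (simp add: eq_diff_eq)
    ultimately have "\<not> inj ?f" unfolding inj_def by blast
    then have "\<not> surj ?f" using finite_UNIV_surj_inj[of ?f] by auto
    then obtain b where b: "b \<notin> range ?f" by blast
    have "x\<^sup>2 \<noteq> a * x + b" for x
    proof
      assume "x\<^sup>2 = a * x + b"
      then have "b = ?f x" by simp
      then show False using b by blast
    qed
    then show ?thesis by blast
  qed
  then have "\<exists>\<beta>. \<forall>a\<in>A. \<forall>x. x\<^sup>2 \<noteq> a * x + \<beta> a" by (intro bchoice) blast
  moreover have "3 \<le> card A"
  proof (cases "\<exists>x :: 'a. x + x \<noteq> 0")
    case True
    \<comment> \<open>In characteristic other than 2 every \<open>a\<close> qualifies, with 0 as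
      witness for nonzero \<open>a\<close> and \<open>x\<close> as witness for 0.\<close>
    then obtain x :: 'a where x: "x + x \<noteq> 0" by blast
    have "a \<in> A" for a
    proof (cases "a = 0")
      case False
      then have "(0 :: 'a) + 0 \<noteq> a" by simp
      then show ?thesis unfolding A_def by blast
    qed (use x in \<open>auto simp: A_def\<close>)
    then have "A = UNIV" by blast
    then show ?thesis using assms by simp
  next
    case False
    \<comment> \<open>In characteristic 2 exactly the nonzero \<open>a\<close> qualify; a third
      element \<open>c\<close> of the field yields three of them.\<close>
    have "card {0, 1 :: 'a} < CARD('a)" using assms by simp
    then have "{0, 1 :: 'a} \<noteq> UNIV" by (intro notI) (simp only: less_irrefl)
    then obtain c :: 'a where c: "c \<notin> {0, 1}" by blast
    have "c + 1 \<noteq> 0"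
    proof
      assume "c + 1 = 0"
      moreover have "(1 :: 'a) + 1 = 0" using False by blast
      ultimately have "c + 1 = 1 + 1" by (simp only:)
      then have "c = 1" by (simp only: add_right_cancel)
      then show False using c by simp
    qed
    then have "{1, c, c + 1} \<subseteq> A"
      using c by (auto simp: A_def intro: exI[of _ 0])
    then have "card {1, c, c + 1} \<le> card A" by (intro card_mono) auto
    moreover have "card {1, c, c + 1} = 3" using c by auto
    ultimately show ?thesis by simp
  qed
  ultimately show ?thesis by blast
qed

text \<open>In the basis s, e the operator \<open>B i 1\<close> is the companion operator of t^2 - a
  t - \<beta>(a). Since this polynomial has no root there is no eigenvector, which is regularity for
  \<open>r = 2\<close>. The image of e gives back s, and the image of s gives back a.\<close>

lemma ex_operator_system_quadratic:
  fixes S :: "('a::{field,finite} ^ 'n::finite) set"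
  assumes S: "vec.subspace S" "vec.dim S = 2" and n: "CARD('n) = 4" and q: "3 \<le> CARD('a)"
  shows "\<exists>b (I :: ('a \<times> ('a ^ 'n)) set) B. operator_system S b 2 I B \<and>
    3 * (CARD('a) ^ 2 - CARD('a)) \<le> card I"
proof -
  let ?q = "CARD('a)"
  obtain b where b: "complementary_basis S b 2"
    using ex_complementary_basis[OF S(1), of 2] S(2) n by auto
  obtain A :: "'a set" and \<beta> where A: "3 \<le> card A" "\<And>a x. a \<in> A \<Longrightarrow> x\<^sup>2 \<noteq> a * x + \<beta> a"
    using ex_rootless_quadratics[OF q] by blast
  obtain e where e: "e \<in> S" "e \<noteq> 0"
    using vec.dim_eq_0[of S] S(2) by auto
  have span_e: "vec.span {e} \<subseteq> S" using e S(1) by (intro vec.span_minimal) auto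
  have cS: "card S = ?q ^ 2" using card_subspace[OF S(1)] S(2) by simp
  define I where "I = A \<times> (S - vec.span {e})"
  define img where "img = (\<lambda>(a, s) x. if x = e then s else a *s s + \<beta> a *s e)"
  define B where "B = (\<lambda>i (k :: nat). if k = 0 then (\<lambda>x. x) else vec.construct {snd i, e} (img i))"
  have ind: "vec.independent {s, e}" if "s \<notin> vec.span {e}" for s
    using that e by (intro vec.independent_insertI vec.independent_empty) auto
  have lin: "Vector_Spaces.linear (*s) (*s) (B i k)" if "i \<in> I" for i k
    using that vec.linear_construct[OF ind] vec.linear_ident by (auto simp: B_def I_def)
  have B_e: "B i 1 e = snd i" if "i \<in> I" for i
    using that vec.construct_basis[OF ind, of "snd i" e "img i"]
    by (auto simp: B_def I_def img_def split_beta)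
  have B_s: "B i 1 (snd i) = fst i *s snd i + \<beta> (fst i) *s e" if "i \<in> I" for i
  proof -
    have "snd i \<noteq> e" using that vec.span_base[of e "{e}"] by (auto simp: I_def)
    then show ?thesis
      using that vec.construct_basis[OF ind, of "snd i" "snd i" "img i"]
      by (auto simp: B_def I_def img_def split_beta)
  qed
  have coeff: "x = 0 \<and> y = 0" if "x *s s + y *s e = 0" "s \<notin> vec.span {e}" for x y s
  proof -
    have "x = 0"
    proof (rule ccontr)
      assume "x \<noteq> 0"
      have "x *s s = (- y) *s e" using that(1) by (simp only: eq_neg_iff_add_eq_0 vec.scale_minus_left)
      then have "inverse x *s (x *s s) \<in> vec.span {e}"
        by (simp only:) (intro vec.span_scale vec.span_base, simp)
      then have "s \<in> vec.span {e}" using \<open>x \<noteq> 0\<close> by (simp add: vector_smult_assoc)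
      then show False using that(2) by simp
    qed
    moreover from this have "y *s e = 0" using that(1) by simp
    ultimately show ?thesis using e(2) by (simp add: vec.scale_eq_0_iff)
  qed
  have "operator_system S b 2 I B"
  proof (intro operator_system.intro b operator_system_axioms.intro)
    show "vec.dim S \<noteq> 0" using S(2) by simp
    show "finite I" by simp
    fix i assume i: "i \<in> I"
    then obtain a s where s: "i = (a, s)" "a \<in> A" "s \<in> S" "s \<notin> vec.span {e}" by (auto simp: I_def)
    have "card (vec.span {s, e}) = ?q ^ 2"
      using vec.card_span_independent[OF _ _ ind[OF s(4)]] s(4) vec.span_base[of e "{e}"]
      by (auto simp: card_insert_if power2_eq_square)
    moreover have "vec.span {s, e} \<subseteq> S" using s e S(1) by (intro vec.span_minimal) auto
    ultimately have span_S: "vec.span {s, e} = S"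
      using cS by (intro card_subset_eq) auto
    have decomp: "\<exists>x y. u = x *s s + y *s e" if "u \<in> S" for u
    proof -
      have "u \<in> vec.span (insert s {e})" using that span_S by simp
      then obtain x where "u - x *s s \<in> vec.span {e}" unfolding vec.span_breakdown_eq by blast
      then obtain y where "u - x *s s = y *s e" by (auto simp: vec.span_singleton)
      then have "u = x *s s + y *s e" by (simp add: diff_eq_eq add.commute)
      then show ?thesis by blast
    qed
    have B_add: "B i k (x + y) = B i k x + B i k y" for k x y
      using lin[OF i] by (rule vec.linear_add)
    have B_scale: "B i k (c *s x) = c *s B i k x" for k c x
      using lin[OF i] by (rule vec.linear_scale)
    have B_1: "B i 1 (x *s s + y *s e) = (x * a + y) *s s + (x * \<beta> a) *s e" for x y
    proof -
      have "B i 1 s = a *s s + \<beta> a *s e" "B i 1 e = s" using B_e[OF i] B_s[OF i] s(1) by simp_all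
      then have "B i 1 (x *s s + y *s e) = x *s (a *s s + \<beta> a *s e) + y *s s"
        by (simp only: B_add B_scale)
      then show ?thesis
        by (simp add: vec.scale_right_distrib vec.scale_left_distrib vector_smult_assoc algebra_simps)
    qed
    show "B i k (x + y) = B i k x + B i k y" for k x y by (rule B_add)
    show "B i k (c *s x) = c *s B i k x" for k c x by (rule B_scale)
    show "B i 0 x = x" for x by (simp add: B_def)
    show "B i k u \<in> S" if "k < 2" "u \<in> S" for k u
    proof (cases "k = 0")
      case False
      then have "k = 1" using that by simp
      from decomp[OF that(2)] obtain x y where "u = x *s s + y *s e" by blast
      then show ?thesis
        unfolding \<open>k = 1\<close> using B_1 s(3) e(1) by (simp only:) (intro vec.subspace_add[OF S(1)] vec.subspace_scale[OF S(1)])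
    qed (use that in \<open>simp add: B_def\<close>)
    show "c k = 0" if u: "u \<in> S" "u \<noteq> 0" and zero: "(\<Sum>k<2. c k *s B i k u) = 0" and k: "k < 2" for c k u
    proof -
      obtain x y where xy: "u = x *s s + y *s e" using decomp[OF u(1)] by blast
      have "(c 0 * x + c 1 * (x * a + y)) *s s + (c 0 * y + c 1 * (x * \<beta> a)) *s e
          = c 0 *s u + c 1 *s B i 1 u"
        unfolding xy B_1
        by (simp add: vec.scale_right_distrib vec.scale_left_distrib vector_smult_assoc algebra_simps)
      also have "\<dots> = 0" using zero by (simp add: numeral_2_eq_2 B_def)
      finally have eqs: "c 0 * x + c 1 * (x * a + y) = 0" "c 0 * y + c 1 * (x * \<beta> a) = 0"
        using coeff s(4) by blast+
      have c1: "c 1 = 0"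
      proof (rule ccontr)
        assume c1: "c 1 \<noteq> 0"
        \<comment> \<open>\<open>u\<close> would be an eigenvector of \<open>B i 1\<close> with
          eigenvalue \<open>l\<close>, making \<open>l\<close> a root of the rootless
          polynomial.\<close>
        define l where "l = - c 0 / c 1"
        have c0: "c 0 = - l * c 1" using c1 by (simp add: l_def)
        have "c 1 * (x * a + y - l * x) = 0" "c 1 * (x * \<beta> a - l * y) = 0"
          using eqs by (simp_all add: c0 algebra_simps)
        then have "x * a + y - l * x = 0" "x * \<beta> a - l * y = 0"
          using c1 by (simp_all only: mult_eq_0_iff simp_thms)
        then have y: "y = l * x - x * a" and "x * \<beta> a = l * y"
          by (simp_all add: algebra_simps eq_diff_eq)
        have "x * (l\<^sup>2 - (a * l + \<beta> a)) = l * (l * x - x * a) - x * \<beta> a"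
          by (simp add: power2_eq_square algebra_simps)
        also have "\<dots> = 0"
          by (simp only: y[symmetric] \<open>x * \<beta> a = l * y\<close> diff_self)
        finally have "x * (l\<^sup>2 - (a * l + \<beta> a)) = 0" .
        moreover have "x \<noteq> 0" using y xy u(2) by auto
        ultimately have "l\<^sup>2 = a * l + \<beta> a" by simp
        then show False using A(2)[OF s(2)] by blast
      qed
      then have "c 0 *s u = 0" using zero by (simp add: numeral_2_eq_2 B_def)
      then have "c 0 = 0" using u(2) by (simp only: vec.scale_eq_0_iff) simp
      then show ?thesis using c1 k by (auto simp: less_2_cases_iff)
    qed
    show "\<exists>x\<in>S. B i 1 x \<noteq> B j 1 x" if j: "j \<in> I" "i \<noteq> j" for j
    proof (rule ccontr)
      assume "\<not> ?thesis"
      then have eq: "B i 1 x = B j 1 x" if "x \<in> S" for x using that by blast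
      have s_eq: "snd j = s" using eq[OF e(1)] B_e[OF i] B_e[OF j(1)] s(1) by simp
      have "a *s s + \<beta> a *s e = fst j *s s + \<beta> (fst j) *s e"
        using eq[OF s(3)] B_s[OF i] B_s[OF j(1)] s(1) s_eq by simp
      then have "(a - fst j) *s s + (\<beta> a - \<beta> (fst j)) *s e = 0"
        by (simp add: vec.scale_left_diff_distrib algebra_simps)
      then have "a = fst j" using coeff[OF _ s(4)] by fastforce
      then show False using s_eq s(1) j(2) by (simp add: prod_eq_iff)
    qed
  qed simp
  moreover have "3 * (?q ^ 2 - ?q) \<le> card I"
  proof -
    have "card (vec.span {e}) = ?q" using vec.card_span_independent[of "{e}"] e by simp
    then have "card (S - vec.span {e}) = ?q ^ 2 - ?q"
      using cS span_e by (simp add: card_Diff_subset)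
    then show ?thesis using A(1) by (simp add: I_def card_cartesian_product)
  qed
  ultimately have "operator_system S b 2 I B \<and> 3 * (?q ^ 2 - ?q) \<le> card I" by (rule conjI)
  then show ?thesis by (intro exI)
qed

subsection \<open>The binary case in dimension four\<close>

text \<open>By dimension \<open>S\<close> and \<open>V\<close> span everything, so each
  \<open>b i\<close> can be moved into \<open>V\<close> by some \<open>w i\<close> in
  \<open>S\<close>. The graph of \<open>w\<close> then lies in \<open>V\<close> and has the same
  dimension.\<close>

lemma (in complementary_basis) ex_graph_eq:
  assumes V: "vec.subspace V" "vec.dim V = r" "V \<inter> S \<subseteq> {0}" and n: "vec.dim S + r = CARD('n)"
  shows "\<exists>w. w \<in> {..<r} \<rightarrow> S \<and> V = graph w"
proof -
  have "vec.dim (S \<inter> V) = 0"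
    using V(3) vec.dim_eq_0[of "S \<inter> V"] by blast
  then have "vec.dim (subspace_sum S V) = CARD('n)"
    using dim_subspace_sum[OF S V(1)] V(2) n by linarith
  then have sum_UNIV: "subspace_sum S V = UNIV"
    by (intro vec.subspace_dim_equal subspace_subspace_sum[OF S V(1)] vec.subspace_UNIV)
      (simp_all add: card_cart_basis)
  have "\<exists>w\<in>S. b i + w \<in> V" for i
  proof -
    have "b i \<in> subspace_sum S V" by (simp only: sum_UNIV UNIV_I)
    then obtain x y where xy: "x \<in> S" "y \<in> V" "b i = x + y"
      unfolding subspace_sum_def by blast
    have "- x \<in> S" using xy(1) by (rule vec.subspace_neg[OF S])
    moreover have "b i + - x \<in> V" using xy(2,3) by simp
    ultimately show ?thesis by (rule bexI[rotated])
  qed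
  then have "\<forall>i. \<exists>w. w \<in> S \<and> b i + w \<in> V" by blast
  then obtain w where "\<forall>i. w i \<in> S \<and> b i + w i \<in> V" unfolding choice_iff by (elim exE)
  then have w: "w i \<in> S" "b i + w i \<in> V" for i by simp_all
  have w_Pi: "w \<in> {..<r} \<rightarrow> S" using w(1) by simp
  have "comb w c \<in> V" for c
    unfolding comb_def by (intro vec.subspace_sum[OF V(1)] vec.subspace_scale[OF V(1)] w(2))
  then have "graph w \<subseteq> V" by (auto simp: graph_def)
  moreover have "vec.dim (graph w) = vec.dim V"
    using dim_graph[OF w_Pi] V(2) by simp
  ultimately have "graph w = V"
    using vec.subspace_dim_equal[OF subspace_graph V(1)] by simp
  then show ?thesis using w_Pi by (intro exI[of _ w]) simp
qed

lemma (in complementary_basis) graph_Int_trivialD: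
  assumes v: "v \<in> {..<r} \<rightarrow> S" and w: "w \<in> {..<r} \<rightarrow> S" and "graph v \<inter> graph w \<subseteq> {0}"
    and "(\<Sum>i<r. c i *s (v i - w i)) = 0" "i < r"
  shows "c i = 0"
proof -
  have "comb v c \<in> graph w" using comb_in_graph_iff[OF v w] assms(4) by simp
  then have "comb v c = 0" using assms(3) by (auto simp: graph_def)
  then have "comb v c - comb v (\<lambda>_. 0) \<in> S" using vec.subspace_0[OF S] by (simp add: comb_def)
  from comb_diff_in_S[OF v v this assms(5)] show ?thesis .
qed

lemma card2_field:
  fixes x :: "'a::{field,finite}"
  assumes "CARD('a) = 2"
  shows "x = 0 \<or> x = 1" and "(1 :: 'a) + 1 = 0"
proof -
  have "{0, 1 :: 'a} = UNIV" using assms by (intro card_subset_eq) auto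
  then have *: "y = 0 \<or> y = 1" for y :: 'a by auto
  then show "x = 0 \<or> x = 1" by blast
  have "(1 :: 'a) + 1 \<noteq> 1"
  proof
    assume "(1 :: 'a) + 1 = 1"
    then have "(1 :: 'a) + 1 = 1 + 0" by (simp only: add_0_right)
    then have "(1 :: 'a) = 0" by (simp only: add_left_cancel)
    then show False by simp
  qed
  then show "(1 :: 'a) + 1 = 0" using * by blast
qed

lemma card2_vec_add_self:
  fixes x :: "'a::{field,finite} ^ 'n::finite"
  assumes "CARD('a) = 2"
  shows "x + x = 0"
proof -
  have "x + x = (1 + 1) *s x" by (simp only: vec.scale_left_distrib vec.scale_one)
  then show ?thesis by (simp only: card2_field(2)[OF assms] vec.scale_zero_left)
qed

text \<open>Over two elements the only nontrivial combinations are u, v and u + v. Trivial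
  intersection of two graphs thus becomes three disequalities between rows.\<close>

lemma card2_independent:
  fixes u v :: "'a::{field,finite} ^ 'n::finite"
  assumes "CARD('a) = 2" "u \<noteq> 0" "v \<noteq> 0" "u \<noteq> v" "x *s u + y *s v = 0"
  shows "x = 0 \<and> y = 0"
proof -
  have "u + v \<noteq> 0"
  proof
    assume "u + v = 0"
    then have "u + v = v + v" by (simp only: card2_vec_add_self[OF assms(1)])
    then show False using assms(4) by simp
  qed
  then show ?thesis
    using assms(2,3,5) card2_field(1)[OF assms(1), of x] card2_field(1)[OF assms(1), of y] by auto
qed

definition extensions :: "('a::field ^ 'n::finite) set set \<Rightarrow> ('a ^ 'n) set set" where
  "extensions C = {L. L \<notin> C \<and> insert L C \<in> codes 2}"

lemma extensionsI:
  assumes C: "C \<in> codes 2" and L: "vec.subspace L" "vec.dim L = 2"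
    and disj: "\<And>V. V \<in> C \<Longrightarrow> L \<inter> V \<subseteq> {0}"
  shows "L \<in> extensions C"
proof -
  have dim0: "vec.dim (L \<inter> V) = 0" if "V \<in> C" for V
    using disj[OF that] vec.dim_eq_0[of "L \<inter> V"] by blast
  then have "L \<notin> C" using L(2) by fastforce
  moreover have "insert L C \<in> codes 2"
  proof (rule codesI)
    fix U V assume "U \<in> insert L C" "V \<in> insert L C" "U \<noteq> V"
    then consider "U \<in> C" "V \<in> C" | "U = L" "V \<in> C" | "U \<in> C" "V = L" by auto
    then have "vec.dim (U \<inter> V) = 0"
    proof cases
      case 1 then show ?thesis using codesD(3)[OF C _ _ \<open>U \<noteq> V\<close>] by fastforce
    next
      case 2 then show ?thesis using dim0 by simp
    next
      case 3 then show ?thesis using dim0[of U] by (simp add: Int_commute)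
    qed
    then show "vec.dim (U \<inter> V) + 2 \<le> 2" by simp
  qed (use L codesD[OF C] in auto)
  ultimately show ?thesis by (simp add: extensions_def)
qed

text \<open>Double counting of the pairs of a code with k + 1 members and one distinguished member;
  removing that member leaves a code of size k.\<close>

lemma card_codes_Suc:
  fixes e :: nat
  assumes "\<And>C :: ('a::{field,finite} ^ 'n::finite) set set. C \<in> codes 2 \<Longrightarrow> card C = k \<Longrightarrow> e \<le> card (extensions C)"
  shows "e * card {C :: ('a ^ 'n) set set. C \<in> codes 2 \<and> card C = k}
    \<le> Suc k * card {C :: ('a ^ 'n) set set. C \<in> codes 2 \<and> card C = Suc k}"
proof -
  let ?A = "\<lambda>k. {C :: ('a ^ 'n) set set. C \<in> codes 2 \<and> card C = k}"
  have "e * card (?A k) \<le> (\<Sum>C\<in>?A k. card (extensions C))"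
    using sum_mono[of "?A k" "\<lambda>_. e" "\<lambda>C. card (extensions C)"] assms by (simp add: mult.commute)
  also have "\<dots> = card (Sigma (?A k) extensions)" by (simp add: card_SigmaI)
  also have "\<dots> \<le> card (Sigma (?A (Suc k)) (\<lambda>C. C))"
  proof (rule card_inj_on_le[where f = "\<lambda>(C, L). (insert L C, L)"])
    show "inj_on (\<lambda>(C, L). (insert L C, L)) (Sigma (?A k) extensions)"
      by (rule inj_on_inverseI[where g = "\<lambda>(C, L). (C - {L}, L)"]) (auto simp: extensions_def)
    show "(\<lambda>(C, L). (insert L C, L)) ` Sigma (?A k) extensions \<subseteq> Sigma (?A (Suc k)) (\<lambda>C. C)"
      by (auto simp: extensions_def)
  qed simp
  also have "\<dots> = (\<Sum>C\<in>?A (Suc k). card C)" by (simp add: card_SigmaI)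
  also have "\<dots> = Suc k * card (?A (Suc k))" by simp
  finally show ?thesis .
qed

context
  assumes q: "CARD('a::{field,finite}) = 2" and n: "CARD('n::finite) = 4"
begin

text \<open>There are 15 * 14 = 210 ordered pairs of distinct nonzero vectors, each spans a plane,
  and a plane contains 3 * 2 = 6 of them.\<close>

lemma card_extensions_empty: "35 \<le> card (extensions ({} :: ('a ^ 'n) set set))"
proof -
  let ?E = "extensions ({} :: ('a ^ 'n) set set)"
  define D where "D = Sigma (UNIV - {0 :: 'a ^ 'n}) (\<lambda>x. UNIV - {0, x})"
  define fib where "fib = (\<lambda>L :: ('a ^ 'n) set. Sigma (L - {0}) (\<lambda>x. L - {0, x}))"
  have "card (UNIV :: ('a ^ 'n) set) = 16"
    using card_subspace[OF vec.subspace_UNIV, where 'a = 'a and 'n = 'n] q n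
    by (simp add: card_cart_basis)
  then have "card D = 210" by (simp add: D_def card_SigmaI card_Diff_subset)
  have "D \<subseteq> (\<Union>L\<in>?E. fib L)"
  proof
    fix p assume "p \<in> D"
    then obtain x y where p: "p = (x, y)" "x \<noteq> 0" "y \<noteq> 0" "x \<noteq> y" by (auto simp: D_def)
    have "y \<notin> vec.span {x}"
    proof
      assume "y \<in> vec.span {x}"
      then obtain c where "y = c *s x" by (auto simp: vec.span_singleton)
      then show False using card2_field(1)[OF q, of c] p by auto
    qed
    then have "vec.independent {y, x}"
      using p by (intro vec.independent_insertI vec.independent_empty) auto
    then have "vec.dim (vec.span {y, x}) = 2"
      using p vec.dim_span_eq_card_independent[of "{y, x}"] by simp
    then have "vec.span {y, x} \<in> ?E"
      using vec.subspace_span by (intro extensionsI) (auto intro: codesI)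
    moreover have "p \<in> fib (vec.span {y, x})"
      using p vec.span_base[of _ "{y, x}"] by (auto simp: fib_def)
    ultimately show "p \<in> (\<Union>L\<in>?E. fib L)" by blast
  qed
  then have "card D \<le> card (\<Union>L\<in>?E. fib L)" by (intro card_mono) auto
  also have "\<dots> \<le> (\<Sum>L\<in>?E. card (fib L))" by (rule card_UN_le) simp
  also have "\<dots> = (\<Sum>L\<in>?E. 6)"
  proof (rule sum.cong)
    fix L assume "L \<in> ?E"
    then have L: "vec.subspace L" "vec.dim L = 2"
      using codesD(1,2)[of "{L}" 2 L] by (auto simp: extensions_def)
    then have "card L = 4" using card_subspace[OF L(1)] q by simp
    moreover have "0 \<in> L" using L(1) by (rule vec.subspace_0)
    ultimately show "card (fib L) = 6" by (simp add: fib_def card_SigmaI card_Diff_subset)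
  qed simp
  finally show ?thesis using \<open>card D = 210\<close> by simp
qed

text \<open>All members of \<open>C\<close> other than \<open>S\<close> are graphs over
  \<open>S\<close>. The candidates are the graphs of \<open>w\<close> shifted by a pair in
  \<open>P\<close>, and \<open>disj\<close> makes the rows of their difference to each such member
  independent. Where \<open>C\<close> has a member besides \<open>S\<close>, one of these serves as
  base point \<open>w\<close>.\<close>

lemma card_extensions_ge:
  fixes S :: "('a ^ 'n) set" and w :: "nat \<Rightarrow> 'a ^ 'n"
  assumes b: "complementary_basis S b 2" and C: "C \<in> codes 2" "S \<in> C"
    and w: "w \<in> {..<2} \<rightarrow> S" and P: "P \<subseteq> S \<times> S"
    and disj: "\<And>x y v. (x, y) \<in> P \<Longrightarrow> v \<in> {..<2} \<rightarrow> S \<Longrightarrow> complementary_basis.graph b 2 v \<in> C \<Longrightarrow>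
      w 0 + x - v 0 \<noteq> 0 \<and> w 1 + y - v 1 \<noteq> 0 \<and> w 0 + x - v 0 \<noteq> w 1 + y - v 1"
  shows "card P \<le> card (extensions C)"
proof -
  interpret complementary_basis S b 2 by (rule b)
  define t where "t = (\<lambda>(x, y) (i :: nat). w i + (if i = 0 then x else y))"
  have t: "t p \<in> {..<2} \<rightarrow> S" if "p \<in> P" for p
    using that P w by (auto simp: t_def intro!: vec.subspace_add[OF S])
  have "inj_on (\<lambda>p. graph (t p)) P"
  proof (rule inj_onI)
    fix p p' assume p: "p \<in> P" "p' \<in> P" "graph (t p) = graph (t p')"
    have "t p 0 = t p' 0" "t p 1 = t p' 1"
      using graph_inj[OF t[OF p(1)] t[OF p(2)] p(3)] by auto
    then show "p = p'" by (cases p, cases p') (auto simp: t_def)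
  qed
  moreover have "(\<lambda>p. graph (t p)) ` P \<subseteq> extensions C"
  proof clarify
    fix x y assume p: "(x, y) \<in> P"
    show "graph (t (x, y)) \<in> extensions C"
    proof (rule extensionsI[OF C(1) subspace_graph dim_graph[OF t[OF p]]])
      fix V assume V: "V \<in> C"
      show "graph (t (x, y)) \<inter> V \<subseteq> {0}"
      proof (cases "V = S")
        case True
        then show ?thesis using graph_Int_S[OF t[OF p]] by simp
      next
        case False
        then have "vec.dim (V \<inter> S) + 2 \<le> 2" using codesD(3)[OF C(1) V C(2)] by simp
        then have "V \<inter> S \<subseteq> {0}" using vec.dim_eq_0[of "V \<inter> S"] by simp
        then obtain v where v: "v \<in> {..<2} \<rightarrow> S" "V = graph v"
          using ex_graph_eq[of V] codesD(1,2)[OF C(1) V] codesD(2)[OF C] n by auto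
        have "vec.dim (graph (t (x, y)) \<inter> graph v) + 2 \<le> 2"
        proof (rule dim_graph_Int_graph[OF t[OF p] v(1), of 0 1])
          fix c d assume "c *s (t (x, y) 0 - v 0) + d *s (t (x, y) 1 - v 1) = 0"
          then show "c = 0 \<and> d = 0"
            using disj[OF p v(1)] V v(2)
            by (intro card2_independent[OF q, of "t (x, y) 0 - v 0" "t (x, y) 1 - v 1"]) (auto simp: t_def)
        qed auto
        then show ?thesis using v(2) vec.dim_eq_0[of "graph (t (x, y)) \<inter> graph v"] by simp
      qed
    qed
  qed
  ultimately show ?thesis by (intro card_inj_on_le[where f = "\<lambda>p. graph (t p)"]) auto
qed

lemma card_extensions_le3:
  fixes C :: "('a ^ 'n) set set"
  assumes C: "C \<in> codes 2" and k: "card C \<in> {1, 2, 3}"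
  shows "(if card C = 1 then 16 else if card C = 2 then 6 else 2) \<le> card (extensions C)"
proof -
  obtain S C' where SC: "C = insert S C'" "S \<notin> C'" "card C = Suc (card C')"
  proof -
    have "C \<noteq> {}" using k by auto
    then obtain S where S: "S \<in> C" by blast
    have "card C = Suc (card (C - {S}))" using S by (intro card.remove) auto
    then show ?thesis using S that[of S "C - {S}"] by blast
  qed
  have S: "vec.subspace S" and dim_S: "vec.dim S = 2" using codesD(1,2)[OF C] SC by auto
  have cS: "card S = 4" using card_subspace[OF S] dim_S q by simp
  have S0: "0 \<in> S" using S by (rule vec.subspace_0)
  have add_S: "x + y \<in> S" if "x \<in> S" "y \<in> S" for x y using that S by (rule vec.subspace_add[rotated])
  obtain b where b: "complementary_basis S b 2"
    using ex_complementary_basis[OF S, of 2] dim_S n by auto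
  interpret complementary_basis S b 2 by (rule b)
  have graph: "\<exists>v. v \<in> {..<2} \<rightarrow> S \<and> V = graph v" if "V \<in> C'" for V
  proof -
    have V: "V \<in> C" "V \<noteq> S" using that SC by auto
    have "vec.dim (V \<inter> S) + 2 \<le> 2" using codesD(3)[OF C V(1) _ V(2)] SC by simp
    then have "V \<inter> S \<subseteq> {0}" using vec.dim_eq_0[of "V \<inter> S"] by simp
    then show ?thesis using ex_graph_eq[of V] codesD(1,2)[OF C V(1)] dim_S n by auto
  qed
  have graph_S: "graph v \<noteq> S" if "v \<in> {..<2} \<rightarrow> S" for v
  proof
    assume "graph v = S"
    then have "S = {0}" using graph_Int_S[OF that] by simp
    then show False using cS by simp
  qed
  have eq: "v 0 = w 0 \<and> v 1 = w 1" if "v \<in> {..<2} \<rightarrow> S" "w \<in> {..<2} \<rightarrow> S" "graph v = graph w" for v w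
    using graph_inj[OF that] by auto
  consider "card C' = 0" | "card C' = 1" | "card C' = 2" using k SC(3) by auto
  then show ?thesis
  proof cases
    case 1
    then have C': "C' = {}" by simp
    \<comment> \<open>Every graph avoids \<open>S\<close>, which gives all 4 * 4 shifts.\<close>
    have "card (S \<times> S) \<le> card (extensions C)"
    proof (rule card_extensions_ge[OF b C, where w = "\<lambda>_. 0"])
      fix v assume "v \<in> {..<2} \<rightarrow> S" "graph v \<in> C"
      then show "0 + x - v 0 \<noteq> 0 \<and> 0 + y - v 1 \<noteq> 0 \<and> 0 + x - v 0 \<noteq> 0 + y - v 1" for x y
        using graph_S SC C' by auto
    qed (use SC S0 in auto)
    then show ?thesis using 1 SC(3) cS by (simp add: card_cartesian_product)
  next
    case 2
    then obtain V where V: "C' = {V}" by (auto simp: card_1_singleton_iff)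
    then obtain w where w: "w \<in> {..<2} \<rightarrow> S" "V = graph w" using graph by auto
    \<comment> \<open>Relative to the one other member, both rows must be nonzero and distinct: 3 *
      2 shifts.\<close>
    have "card (Sigma (S - {0}) (\<lambda>x. S - {0, x})) \<le> card (extensions C)"
    proof (rule card_extensions_ge[OF b C, where w = w])
      fix x y v assume xy: "(x, y) \<in> Sigma (S - {0}) (\<lambda>x. S - {0, x})"
        and v: "v \<in> {..<2} \<rightarrow> S" "graph v \<in> C"
      then have "graph v = graph w" using graph_S SC V w by auto
      then have "v 0 = w 0 \<and> v 1 = w 1" by (rule eq[OF v(1) w(1)])
      then show "w 0 + x - v 0 \<noteq> 0 \<and> w 1 + y - v 1 \<noteq> 0 \<and> w 0 + x - v 0 \<noteq> w 1 + y - v 1"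
        using xy by auto
    qed (use SC w in auto)
    moreover have "card (Sigma (S - {0}) (\<lambda>x. S - {0, x})) = 6"
      using cS S0 by (simp add: card_SigmaI card_Diff_subset)
    ultimately show ?thesis using 2 SC(3) by simp
  next
    case 3
    then obtain V W where VW: "C' = {V, W}" "V \<noteq> W" by (auto simp: card_2_iff)
    obtain v where v: "v \<in> {..<2} \<rightarrow> S" "V = graph v" using graph[of V] VW(1) by auto
    obtain w where w: "w \<in> {..<2} \<rightarrow> S" "W = graph w" using graph[of W] VW(1) by auto
    define d where "d = (\<lambda>i. v i - w i)"
    have VW_dim: "vec.dim (V \<inter> W) + 2 \<le> 2" using codesD(3)[OF C, of V W] VW SC by simp
    then have triv: "graph v \<inter> graph w \<subseteq> {0}" using vec.dim_eq_0[of "V \<inter> W"] v w by simp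
    have d: "x = 0 \<and> y = 0" if "x *s d 0 + y *s d 1 = 0" for x y
    proof -
      let ?c = "\<lambda>i :: nat. if i = 0 then x else y"
      have "(\<Sum>i<2. ?c i *s (v i - w i)) = 0" using that by (simp add: numeral_2_eq_2 d_def)
      from graph_Int_trivialD[OF v(1) w(1) triv this, of 0] graph_Int_trivialD[OF v(1) w(1) triv this, of 1]
      show ?thesis by simp
    qed
    have d_ne: "d 0 \<noteq> 0" "d 1 \<noteq> 0" "d 0 + d 1 \<noteq> 0"
      using d[of 1 0] d[of 0 1] d[of 1 1] by auto
    have d_S: "d 0 \<in> S" "d 1 \<in> S"
      using v(1) w(1) by (auto simp: d_def intro!: vec.subspace_diff[OF S])
    have d_neq: "d 0 \<noteq> d 1"
  proof
      assume "d 0 = d 1"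
      then have "d 0 + d 1 = d 1 + d 1" by (simp only:)
      then show False using d_ne(3) by (simp only: card2_vec_add_self[OF q])
    qed
    have twice: "d 0 + d 0 = 0" "d 1 + d 1 = 0" by (rule card2_vec_add_self[OF q])+
    have diff_ne: "d 1 - d 0 \<noteq> 0" "d 0 - d 1 \<noteq> 0" "d 1 - d 0 \<noteq> d 0" "d 1 \<noteq> d 0 - d 1"
      using d_neq d_ne by (simp_all only: diff_eq_eq eq_diff_eq twice right_minus_eq add_0_left not_sym simp_thms)
    \<comment> \<open>The linear map d 0 \<mapsto> d 1 \<mapsto> d 0 + d 1 \<mapsto> d 0 makes
      \<open>S\<close> a copy of the field with four elements. The two pairs are the multiples of (d
      0, d 1) by the two elements other than 0 and 1; the multiples by 0 and 1 are \<open>W\<close>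
      and \<open>V\<close>.\<close>
    have "card {(d 1, d 0 + d 1), (d 0 + d 1, d 0)} \<le> card (extensions C)"
    proof (rule card_extensions_ge[OF b C, where w = w])
      fix x y u assume xy: "(x, y) \<in> {(d 1, d 0 + d 1), (d 0 + d 1, d 0)}"
        and u: "u \<in> {..<2} \<rightarrow> S" "graph u \<in> C"
      then consider "graph u = graph v" | "graph u = graph w" using graph_S SC VW v w by auto
      then show "w 0 + x - u 0 \<noteq> 0 \<and> w 1 + y - u 1 \<noteq> 0 \<and> w 0 + x - u 0 \<noteq> w 1 + y - u 1"
      proof cases
        case 1
        then have "u 0 = v 0 \<and> u 1 = v 1" by (rule eq[OF u(1) v(1)])
        then have eqs: "w 0 + x - u 0 = x - d 0" "w 1 + y - u 1 = y - d 1" by (simp_all add: d_def)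
        from xy have "x - d 0 = d 1 - d 0 \<and> y - d 1 = d 0 \<or> x - d 0 = d 1 \<and> y - d 1 = d 0 - d 1"
          by auto
        then show ?thesis
          unfolding eqs using d_ne diff_ne by (elim disjE conjE) (simp_all only: simp_thms)
      next
        case 2
        then have "u 0 = w 0 \<and> u 1 = w 1" by (rule eq[OF u(1) w(1)])
        then have "w 0 + x - u 0 = x" "w 1 + y - u 1 = y" by simp_all
        then show ?thesis using xy d_ne by auto
      qed
    qed (use SC w d_S add_S in auto)
    moreover have "card {(d 1, d 0 + d 1), (d 0 + d 1, d 0)} = 2" using d_ne by auto
    ultimately show ?thesis using 3 SC(3) by simp
  qed
qed

lemma card_codes_binary_dim4: "1024 \<le> card (codes 2 :: ('a ^ 'n) set set set)"
proof -
  define a where "a k = card {C :: ('a ^ 'n) set set. C \<in> codes 2 \<and> card C = k}" for k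
  have empty: "{} \<in> (codes 2 :: ('a ^ 'n) set set set)" by (rule codesI) auto
  have "{C :: ('a ^ 'n) set set. C \<in> codes 2 \<and> card C = 0} = {{}}" using empty by auto
  then have a0: "a 0 = 1" by (simp add: a_def)
  have ext: "(if k = 1 then 16 else if k = 2 then 6 else 2) \<le> card (extensions C)"
    if "k \<in> {1, 2, 3}" "C \<in> codes 2" "card C = k" for k and C :: "('a ^ 'n) set set"
    using card_extensions_le3[OF that(2), unfolded that(3), OF that(1)] .
  have "35 * a 0 \<le> Suc 0 * a (Suc 0)"
    unfolding a_def using card_extensions_empty by (intro card_codes_Suc) simp
  then have a1: "35 \<le> a 1" using a0 by simp
  have "16 * a 1 \<le> Suc 1 * a (Suc 1)"
    unfolding a_def by (rule card_codes_Suc) (use ext[of 1] in simp)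
  moreover have "Suc 1 = 2" by simp
  ultimately have a2: "16 * a 1 \<le> 2 * a 2" by (simp only:)
  have "6 * a 2 \<le> Suc 2 * a (Suc 2)"
    unfolding a_def by (rule card_codes_Suc) (use ext[of 2] in simp)
  moreover have "Suc 2 = 3" by simp
  ultimately have a3: "6 * a 2 \<le> 3 * a 3" by (simp only:)
  have "2 * a 3 \<le> Suc 3 * a (Suc 3)"
    unfolding a_def by (rule card_codes_Suc) (use ext[of 3] in simp)
  moreover have "Suc 3 = 4" by simp
  ultimately have a4: "2 * a 3 \<le> 4 * a 4" by (simp only:)
  let ?K = "{0, 1, 2, 3, 4} :: nat set"
  \<comment> \<open>The successive bounds are 1, 35, 280, 560 and 280, with sum 1156.\<close>
  have "1024 \<le> a 0 + a 1 + a 2 + a 3 + a 4" using a0 a1 a2 a3 a4 by linarith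
  also have "\<dots> = (\<Sum>k\<in>?K. a k)" by simp
  also have "\<dots> = card (\<Union>k\<in>?K. {C :: ('a ^ 'n) set set. C \<in> codes 2 \<and> card C = k})"
    unfolding a_def by (rule card_UN_disjoint[symmetric]) auto
  also have "\<dots> \<le> card (codes 2 :: ('a ^ 'n) set set set)" by (rule card_mono) auto
  finally show ?thesis .
qed

end

subsection \<open>The lower bound\<close>

text \<open>The bounds for a single \<open>S\<close> come multiplied by \<open>c\<close>; rounding T
  / c up to an integer \<open>H\<close> loses nothing, since the count on the right is an
  integer.\<close>

lemma codes_lower_bound_multiple:
  fixes c :: nat
  assumes n: "CARD('n::finite) = m + r" and r: "2 \<le> r" "r \<le> m" and c: "0 < c"
    and T: "\<And>S :: ('a::{field,finite} ^ 'n) set. vec.subspace S \<Longrightarrow> vec.dim S = m \<Longrightarrow>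
      T \<le> c * card {Z \<in> codes r. \<forall>V\<in>Z. V \<inter> S = {0}}"
  shows "(CARD('a) ^ (m + 1) - 1) * T \<le> c * ((CARD('a) - 1) * card (codes r :: ('a ^ 'n) set set set))"
proof -
  define H where "H = (T + (c - 1)) div c"
  have "T + (c - 1) = c * H + (T + (c - 1)) mod c" by (simp add: H_def)
  moreover have "(T + (c - 1)) mod c < c" using c by simp
  ultimately have TH: "T \<le> c * H" by linarith
  have HX: "H \<le> Z" if "T \<le> c * Z" for Z
  proof -
    have "H \<le> (c * Z + (c - 1)) div c" unfolding H_def using that by (intro div_le_mono) simp
    also have "\<dots> = Z + (c - 1) div c" using c by (intro div_mult_self4) simp
    also have "(c - 1) div c = 0" using c by simp
    finally have "H \<le> Z + 0" .
    then show ?thesis by simp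
  qed
  have "(CARD('a) ^ (m + 1) - 1) * H \<le> (CARD('a) - 1) * card (codes r :: ('a ^ 'n) set set set)"
    using n r by (rule codes_lower_bound) (intro HX T)
  then have "c * ((CARD('a) ^ (m + 1) - 1) * H)
      \<le> c * ((CARD('a) - 1) * card (codes r :: ('a ^ 'n) set set set))"
    by (rule mult_le_mono2)
  moreover have "(CARD('a) ^ (m + 1) - 1) * T \<le> c * ((CARD('a) ^ (m + 1) - 1) * H)"
    using mult_le_mono2[OF TH, of "CARD('a) ^ (m + 1) - 1"] by (simp only: mult.left_commute)
  ultimately show ?thesis by (rule order_trans[rotated])
qed

text \<open>With x = q^m and y = q^(m-1) one has (q - 1)(x + y) = qx - y. The rest follows from x -
  q \<ge> 6, from q^2 \<le> y, which uses m \<ge> 3, and from 4(x^2 - y^2) \<ge> 3x^2, since 6 * 3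
  \<ge> 16.\<close>

lemma card_inequality_dim_ge_3:
  fixes q m :: nat
  assumes "2 \<le> q" "3 \<le> m"
  shows "4 * ((q - 1) * (q ^ m * q ^ m)) \<le> (q ^ (m + 1) - 1) * ((q ^ m - q) * (q ^ m - q ^ 2))"
proof -
  define y where "y = q ^ (m - 1)"
  define x where "x = q ^ m"
  have xy: "x = q * y" unfolding x_def y_def using assms(2) by (simp add: power_eq_if[of q m])
  have y2: "q ^ 2 \<le> y" unfolding y_def using assms by (intro power_increasing) auto
  have y1: "1 \<le> y" using y2 assms(1) by (meson le_trans one_le_numeral one_le_power)
  have x2y: "2 * y \<le> x" unfolding xy using assms(1) by (rule mult_le_mono1)
  have "2 ^ 3 \<le> x"
    unfolding x_def using assms by (meson le_trans power_increasing power_mono zero_le one_le_numeral)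
  have qx: "q * 4 \<le> x"
    unfolding xy using y2 power_mono[OF assms(1), of 2] by (intro mult_le_mono2) simp
  have x6: "6 \<le> x - q" using qx \<open>2 ^ 3 \<le> x\<close> by simp
  have "(q - 1) * (x + y) \<le> q * x - 1"
  proof -
    obtain k where "q = k + 1" using assms(1) by (metis add.commute le_Suc_ex Suc_1 Suc_eq_plus1_left Suc_leD)
    then show ?thesis using y1 xy by (simp add: algebra_simps)
  qed
  have sq: "3 * (x * x) \<le> 4 * ((x + y) * (x - y))"
  proof -
    obtain d where d: "x = 2 * y + d" using x2y le_Suc_ex by blast
    show ?thesis unfolding d by (simp add: algebra_simps)
  qed
  have "16 * (x * x) \<le> 6 * (3 * (x * x))" by simp
  also have "\<dots> \<le> (x - q) * (4 * ((x + y) * (x - y)))" using x6 sq by (rule mult_le_mono)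
  also have "\<dots> = 4 * ((x + y) * ((x - q) * (x - y)))" by (simp only: mult_ac)
  also have "16 * (x * x) = 4 * (4 * (x * x))" by simp
  finally have "4 * (x * x) \<le> (x + y) * ((x - q) * (x - y))" by (rule mult_left_le_imp_le) simp
  also have "\<dots> \<le> (x + y) * ((x - q) * (x - q ^ 2))"
    using y2 by (intro mult_le_mono diff_le_mono2) auto
  finally have "(q - 1) * (4 * (x * x)) \<le> (q - 1) * ((x + y) * ((x - q) * (x - q ^ 2)))"
    by (rule mult_le_mono2)
  also have "\<dots> = ((q - 1) * (x + y)) * ((x - q) * (x - q ^ 2))" by (simp only: mult.assoc)
  also have "\<dots> \<le> (q * x - 1) * ((x - q) * (x - q ^ 2))"
    using \<open>(q - 1) * (x + y) \<le> q * x - 1\<close> by (rule mult_le_mono1)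
  finally show ?thesis by (simp add: x_def mult_ac)
qed

text \<open>Up to the common factor q^2 - q this is 2q^3 \<le> 3(q^3 - 1). With 2 in place of 3 it
  would fail, which is why three traces \<open>a\<close> are needed.\<close>

lemma card_inequality_dim_2:
  fixes q :: nat
  assumes "3 \<le> q"
  shows "2 * ((q - 1) * (q ^ 2 * q ^ 2)) \<le> (q ^ 3 - 1) * (3 * (q ^ 2 - q))"
proof -
  have "3 * 1 \<le> q * q ^ 2" using assms by (intro mult_le_mono) auto
  then have "2 * q ^ 3 \<le> 3 * (q ^ 3 - 1)" by (simp add: power3_eq_cube power2_eq_square)
  then have "(q * (q - 1)) * (2 * q ^ 3) \<le> (q * (q - 1)) * (3 * (q ^ 3 - 1))" by (rule mult_le_mono2)
  also have "q * (q - 1) = q ^ 2 - q" by (simp add: power2_eq_square diff_mult_distrib2)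
  finally have "(q ^ 2 - q) * (2 * q ^ 3) \<le> (q ^ 2 - q) * (3 * (q ^ 3 - 1))" .
  moreover have "(q ^ 2 - q) * (2 * q ^ 3) = 2 * ((q - 1) * (q ^ 2 * q ^ 2))"
    by (simp add: power2_eq_square power3_eq_cube diff_mult_distrib2 mult_ac)
  moreover have "(q ^ 2 - q) * (3 * (q ^ 3 - 1)) = (q ^ 3 - 1) * (3 * (q ^ 2 - q))"
    by (simp only: mult_ac)
  ultimately show ?thesis by (simp only:)
qed

text \<open>Here \<open>k\<close> is the number of operator systems and \<open>1 / c\<close> the
  guaranteed share of large subsets; the third hypothesis is the pure arithmetic that
  remains.\<close>

lemma le_codes_if_system:
  fixes c q k m N M :: nat
  assumes "0 < c" "2 \<le> q" "c * ((q - 1) * (q ^ m * q ^ m)) \<le> (q ^ (m + 1) - 1) * k"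
    and "(q ^ (m + 1) - 1) * (k * q ^ m * 2 ^ N) \<le> c * ((q - 1) * M)"
  shows "q ^ (3 * m) * 2 ^ N \<le> M"
proof -
  have "3 * m = m + m + m" by simp
  then have "q ^ (3 * m) = q ^ m * q ^ m * q ^ m" by (simp only: power_add)
  then have "(c * (q - 1)) * (q ^ (3 * m) * 2 ^ N) = c * ((q - 1) * (q ^ m * q ^ m)) * (q ^ m * 2 ^ N)"
    by (simp add: mult_ac)
  also have "\<dots> \<le> (q ^ (m + 1) - 1) * k * (q ^ m * 2 ^ N)"
    using assms(3) by (rule mult_le_mono1)
  also have "\<dots> = (q ^ (m + 1) - 1) * (k * q ^ m * 2 ^ N)" by (simp only: mult.assoc)
  also have "\<dots> \<le> (c * (q - 1)) * M" using assms(4) by (simp only: mult.assoc)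
  finally show ?thesis using assms(1,2) by simp
qed

lemma codes_bound:
  assumes n: "CARD('n::finite) = m + r" and r: "2 \<le> r" "r \<le> m"
  shows "CARD('a::{field,finite}) ^ (3 * m) * 2 ^ CARD('a) ^ (m * (r - 1))
    \<le> card (codes r :: ('a ^ 'n) set set set)"
proof -
  let ?q = "CARD('a)" and ?N = "CARD('a) ^ (m * (r - 1))"
  have q: "2 \<le> ?q" by (rule two_le_card_field)
  consider "3 \<le> m" | "m = 2" "r = 2" "3 \<le> ?q" | "m = 2" "r = 2" "?q = 2"
    using r q by linarith
  then show ?thesis
  proof cases
    case 1
    let ?k = "(?q ^ m - ?q) * (?q ^ m - ?q ^ 2)"
    have "?k * ?q ^ m * 2 ^ ?N \<le> 4 * card {Z \<in> codes r. \<forall>V\<in>Z. V \<inter> S = {0}}"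
      if sub: "vec.subspace S" "vec.dim S = m" for S :: "('a ^ 'n) set"
    proof -
      obtain b and I :: "(('a ^ 'n) \<times> ('a ^ 'n)) set" and B
        where sys: "operator_system S b r I B" and card_I: "card I = ?k"
        using ex_operator_system_field[OF sub _ 1 r] n by auto
      interpret operator_system S b r I B by (rule sys)
      show ?thesis using card_avoiding(1) unfolding avoiding_def card_I sub(2) .
    qed
    then have "(?q ^ (m + 1) - 1) * (?k * ?q ^ m * 2 ^ ?N)
        \<le> 4 * ((?q - 1) * card (codes r :: ('a ^ 'n) set set set))"
      using n r by (intro codes_lower_bound_multiple) auto
    then show ?thesis
      using card_inequality_dim_ge_3[OF q 1] q by (intro le_codes_if_system[of 4]) auto
  next
    case 2
    let ?k = "3 * (?q ^ 2 - ?q)"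
    have "?k * ?q ^ m * 2 ^ ?N \<le> 2 * card {Z \<in> codes r. \<forall>V\<in>Z. V \<inter> S = {0}}"
      if sub: "vec.subspace S" "vec.dim S = m" for S :: "('a ^ 'n) set"
    proof -
      have "\<exists>b (I :: ('a \<times> ('a ^ 'n)) set) B. operator_system S b 2 I B \<and> ?k \<le> card I"
        using sub n 2 by (intro ex_operator_system_quadratic) auto
      then obtain b and I :: "('a \<times> ('a ^ 'n)) set" and B
        where sys: "operator_system S b r I B" and card_I: "?k \<le> card I"
        unfolding 2 by auto
      interpret operator_system S b r I B by (rule sys)
      have "?k * ?q ^ m * 2 ^ ?N \<le> card I * ?q ^ m * 2 ^ ?N"
        using card_I by (intro mult_le_mono1)
      also have "\<dots> \<le> 2 * card {Z \<in> codes r. \<forall>V\<in>Z. V \<inter> S = {0}}"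
        using card_avoiding(2)[OF 2(3)] unfolding avoiding_def sub(2) .
      finally show ?thesis .
    qed
    then have "(?q ^ (m + 1) - 1) * (?k * ?q ^ m * 2 ^ ?N)
        \<le> 2 * ((?q - 1) * card (codes r :: ('a ^ 'n) set set set))"
      using n r by (intro codes_lower_bound_multiple) auto
    moreover have "2 * ((?q - 1) * (?q ^ m * ?q ^ m)) \<le> (?q ^ (m + 1) - 1) * ?k"
      using card_inequality_dim_2[OF 2(3)] unfolding 2 by simp
    ultimately show ?thesis
      using q by (intro le_codes_if_system[of 2]) auto
  next
    case 3
    \<comment> \<open>The required bound is 2^6 * 2^4 = 1024.\<close>
    then show ?thesis
      using card_codes_binary_dim4[where 'a = 'a and 'n = 'n] n by simp
  qed
qed

theorem proposition14:
  fixes q n r :: nat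
  assumes "q = CARD('a::{field,finite})"
    and "n = CARD('n::finite)"
    and "n \<ge> 4"
    and "2 \<le> r" and "r \<le> n div 2"
  shows "q ^ (3 * (n - r)) * 2 ^ (q ^ ((n - r) * (r - 1))) \<le> num_sparse_paving TYPE('a ^ 'n) r"
proof -
  have "CARD('n) = (n - r) + r" "r \<le> n - r" "r < CARD('n)" using assms by auto
  then show ?thesis
    using codes_bound[where 'a = 'a and 'n = 'n and m = "n - r" and r = r]
      card_codes_le_num_sparse_paving[where 'a = 'a and 'n = 'n and r = r] assms(1,4)
    by auto
qed

end
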